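(* Let $\alpha>0$, $B\in\mathbb{R}$, and let $w:\{0,1,2,\dots\}\to(0,\infty)$ satisfy $\frac{1}{w(n)}=n^{\alpha}\left(1+\frac{2B}{n}+O\left(\frac{1}{n^2}\right)\right)$ as $n\to\infty$. Let $*\in\{-,+,0\}$ and let $(\mathfrak{B}_n,\mathfrak{R}_n)_{n\ge 0}=(\mathfrak{B}^*_n,\mathfrak{R}^*_n)_{n\ge0}$ be the generalized Pólya urn process of type $*$ associated with $w$, with $\mathfrak{D}_n=\mathfrak{R}_n-\mathfrak{B}_n$. Then for every fixed $\delta\in(0,2)$ there exists a constant $C_2$ such that for all sufficiently large integers $n$ and all integers $k,m$ with $\delta n\le k\le m\le 2n$, $$\left|\operatorname{Var}\left(\mathfrak{D}_m\left(\frac{m}{n}\right)^{\alpha}-\mathfrak{D}_k\left(\frac{k}{n}\right)^{\alpha}\right)-n\int_{k/n}^{m/n}u^{2\alpha}\,du\right|\le C_2\sqrt{n}\,\log^2 n.$$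
   Context: No monotonicity of $w$ is assumed. Given sequences of positive numbers $\{b(i)\}_{i\ge0}$ and $\{r(i)\}_{i\ge0}$, the generalized Pólya urn process $\{(\mathfrak{B}_n,\mathfrak{R}_n)\}_{n\ge0}$ is the Markov chain on $\{0,1,2,\dots\}^2$ started at $(0,0)$ which from state $(i,j)$ moves to $(i+1,j)$ with probability $\frac{b(i)}{b(i)+r(j)}$ and to $(i,j+1)$ with probability $\frac{r(j)}{b(i)+r(j)}$. Here $\mathfrak{B}_n$ and $\mathfrak{R}_n$ are the numbers of blue and red balls drawn in the first $n$ draws. For $*\in\{-,+,0\}$, the urn process of type $*$ associated with $w$, denoted $(\mathfrak{B}^*_n,\mathfrak{R}^*_n)_{n\ge0}$, is the one with $b=b^*$, $r=r^*$, where for $i\ge0$: $b^-(i)=w(2i)$, $r^-(i)=w(2i+1)$; $b^+(i)=w(2i+1)$, $r^+(i)=w(2i)$; $b^0(i)=r^0(i)=w(2i)$. The discrepancy is $\mathfrak{D}^*_n=\mathfrak{R}^*_n-\mathfrak{B}^*_n$. The superscript $*$ is dropped in the claim. The constant $C_2$ does not depend on $n,k,m$. *)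

theory Defs
  imports "HOL-Probability.Probability"
begin

text \<open>
  The Markov property is stated by conditioning on every complete history of positive probability.
  Since the two transition probabilities sum to 1, no other move has positive probability.
\<close>

definition polya_urn ::
  "'a measure \<Rightarrow> (nat \<Rightarrow> real) \<Rightarrow> (nat \<Rightarrow> real) \<Rightarrow> (nat \<Rightarrow> 'a \<Rightarrow> nat \<times> nat) \<Rightarrow> bool" where
  "polya_urn M b r X \<longleftrightarrow>
     prob_space M \<and>
     (\<forall>n. X n \<in> measurable M (count_space UNIV)) \<and>
     (AE \<omega> in M. X 0 \<omega> = (0, 0)) \<and>
     (\<forall>n h i j. h n = (i, j) \<longrightarrow> \<P>(\<omega> in M. \<forall>l\<le>n. X l \<omega> = h l) > 0 \<longrightarrow>
        \<P>(\<omega> in M. X (Suc n) \<omega> = (Suc i, j) \<bar> \<forall>l\<le>n. X l \<omega> = h l) = b i / (b i + r j) \<and>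
        \<P>(\<omega> in M. X (Suc n) \<omega> = (i, Suc j) \<bar> \<forall>l\<le>n. X l \<omega> = h l) = r j / (b i + r j))"

datatype urn_type = Minus | Plus | Zero

fun blue_weight :: "urn_type \<Rightarrow> (nat \<Rightarrow> real) \<Rightarrow> nat \<Rightarrow> real" where
  "blue_weight Minus w i = w (2 * i)"
| "blue_weight Plus w i = w (2 * i + 1)"
| "blue_weight Zero w i = w (2 * i)"

fun red_weight :: "urn_type \<Rightarrow> (nat \<Rightarrow> real) \<Rightarrow> nat \<Rightarrow> real" where
  "red_weight Minus w i = w (2 * i + 1)"
| "red_weight Plus w i = w (2 * i)"
| "red_weight Zero w i = w (2 * i)"

definition urn_of_type ::
  "urn_type \<Rightarrow> (nat \<Rightarrow> real) \<Rightarrow> 'a measure \<Rightarrow> (nat \<Rightarrow> 'a \<Rightarrow> nat \<times> nat) \<Rightarrow> bool" where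
  "urn_of_type t w M X \<longleftrightarrow> polya_urn M (blue_weight t w) (red_weight t w) X"

text \<open>The first component of the state counts blue draws, the second one red draws.\<close>

definition discrepancy :: "(nat \<Rightarrow> 'a \<Rightarrow> nat \<times> nat) \<Rightarrow> nat \<Rightarrow> 'a \<Rightarrow> real" where
  "discrepancy X n \<omega> = real (snd (X n \<omega>)) - real (fst (X n \<omega>))"

end

theory Submission
  imports Defs "HOL-Real_Asymp.Real_Asymp"
begin

text \<open>
  Write \<open>D\<^sub>l\<close> for the discrepancy after \<open>l\<close> draws, \<open>\<Delta>\<^sub>l = D\<^sub>l\<^sub>+\<^sub>1 - D\<^sub>l = \<plusminus>1\<close>, and \<open>d\<^sub>l\<close> for the conditional
  mean of \<open>\<Delta>\<^sub>l\<close> given the past. This drift is \<open>(r(j) - b(i)) / (b(i) + r(j))\<close> in the state \<open>(i, j)\<close>, and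
  since both weight sequences decay like \<open>(2i)\<close> to the power \<open>-\<alpha>\<close> up to a factor \<open>1 + O(1/i)\<close>, it equals
  \<open>-\<alpha> D\<^sub>l / l\<close> up to an error of order \<open>D\<^sub>l\<^sup>2 / l\<^sup>2 + 1 / l\<close> (lemma \<open>drift_linearization\<close>). The urn is
  therefore self-correcting, and the weights \<open>l\<^sup>\<alpha>\<close> undo the correction: the process
  \<open>Z\<^sub>l = l\<^sup>\<alpha> D\<^sub>l\<close> satisfies
  \<open>Z\<^sub>l\<^sub>+\<^sub>1 - Z\<^sub>l = (l + 1)\<^sup>\<alpha> \<xi>\<^sub>l + A\<^sub>l\<close>, where \<open>\<xi>\<^sub>l = \<Delta>\<^sub>l - d\<^sub>l\<close> is a martingale difference and, because the
  linear terms in \<open>D\<^sub>l\<close> cancel, \<open>A\<^sub>l = O(l\<^sup>\<alpha> (D\<^sub>l\<^sup>2 / l\<^sup>2 + 1 / l))\<close> (lemma \<open>compensator_bound\<close>).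

  The size of \<open>A\<^sub>l\<close> in mean square is controlled by the fourth moment of \<open>D\<^sub>l\<close>. The product \<open>D\<^sub>l d\<^sub>l\<close> is
  bounded above by a constant (lemma \<open>drift_restoring\<close>): near the diagonal by the expansion of the
  drift, and far from it because the drift then points back to the diagonal. Together with
  \<open>\<Delta>\<^sub>l\<^sup>2 = 1\<close> this gives one-step recursions whose solutions are \<open>E[D\<^sub>l\<^sup>2] = O(l)\<close> and
  \<open>E[D\<^sub>l\<^sup>4] = O(l\<^sup>2)\<close>; so \<open>E[d\<^sub>l\<^sup>2] = O(1/l)\<close> and \<open>E[A\<^sub>l\<^sup>2] = O(l\<^bsup>2\<alpha>-2\<^esup>)\<close>.

  Now let \<open>\<delta> n \<le> k \<le> m \<le> 2 n\<close>, and let \<open>S\<close> and \<open>R\<close> be the sums over \<open>k \<le> l < m\<close> of \<open>(l + 1)\<^sup>\<alpha> \<xi>\<^sub>l\<close> and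
  of \<open>A\<^sub>l\<close>. Martingale differences are orthogonal and \<open>E[\<xi>\<^sub>l\<^sup>2] = 1 - E[d\<^sub>l\<^sup>2]\<close>, so \<open>E[S\<^sup>2]\<close> is the sum of
  \<open>(l + 1)\<^bsup>2\<alpha>\<^esup>\<close> up to \<open>O(n\<^bsup>2\<alpha>\<^esup>)\<close>, hence the integral of \<open>x\<^bsup>2\<alpha>\<^esup>\<close> from \<open>k\<close> to \<open>m\<close> up to the same error, while
  \<open>E[R\<^sup>2] = O(n\<^bsup>2\<alpha>\<^esup>)\<close>. The cross term \<open>2 E[S R]\<close> is the largest error, at most of order
  \<open>n\<^bsup>\<alpha>+1/2\<^esup> n\<^sup>\<alpha>\<close>. Division by \<open>n\<^bsup>2\<alpha>\<^esup>\<close> gives the error \<open>O(\<surd>n)\<close>, which is within the asserted bound.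
\<close>

section \<open>Expansions of real powers\<close>

text \<open>
  Taylor expansion at 1. The interval for \<open>x\<close> covers the two uses: the proportions \<open>1 \<plusminus> x\<close> of the colours
  near the diagonal, and the growth factor \<open>1 + 1 / l\<close> from one step to the next.
\<close>
lemma powr_one_plus_quadratic:
  fixes \<alpha> :: real
  obtains C where "C \<ge> 0"
    and "\<And>x. - 1 / 2 \<le> x \<Longrightarrow> x \<le> 1 \<Longrightarrow> \<bar>(1 + x) powr \<alpha> - 1 - \<alpha> * x\<bar> \<le> C * x\<^sup>2"
proof
  define K where "K = (1 / 2) powr (\<alpha> - 2) + 2 powr (\<alpha> - 2)"
  have K: "t powr (\<alpha> - 2) \<le> K" if "1 / 2 \<le> t" "t \<le> 2" for t
  proof (cases "\<alpha> \<ge> 2")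
    case True
    then have "t powr (\<alpha> - 2) \<le> 2 powr (\<alpha> - 2)"
      using that by (intro powr_mono2) auto
    then show ?thesis by (simp add: K_def add_increasing)
  next
    case False
    then have "t powr (\<alpha> - 2) \<le> (1 / 2) powr (\<alpha> - 2)"
      using that by (intro powr_mono2') auto
    then show ?thesis by (simp add: K_def add_increasing2)
  qed
  show "\<bar>\<alpha> * (\<alpha> - 1)\<bar> * K \<ge> 0" by (simp add: K_def)
  fix x :: real assume x: "- 1 / 2 \<le> x" "x \<le> 1"
  show "\<bar>(1 + x) powr \<alpha> - 1 - \<alpha> * x\<bar> \<le> \<bar>\<alpha> * (\<alpha> - 1)\<bar> * K * x\<^sup>2"
  proof (cases "x = 0")
    case False
    define diff :: "nat \<Rightarrow> real \<Rightarrow> real" where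
      "diff m t = (if m = 0 then t powr \<alpha> else if m = 1 then \<alpha> * t powr (\<alpha> - 1)
        else \<alpha> * (\<alpha> - 1) * t powr (\<alpha> - 2))" for m t
    have D: "\<forall>m t. m < 2 \<and> 1 / 2 \<le> t \<and> t \<le> 2 \<longrightarrow> DERIV (diff m) t :> diff (Suc m) t"
    proof (intro allI impI)
      fix m :: nat and t :: real assume a: "m < 2 \<and> 1 / 2 \<le> t \<and> t \<le> 2"
      then have "m = 0 \<or> m = 1" by auto
      then show "DERIV (diff m) t :> diff (Suc m) t"
      proof
        assume "m = 0"
        then show ?thesis using a
          by (auto simp: diff_def[abs_def] intro!: derivative_eq_intros)
      next
        assume "m = 1"
        then show ?thesis using a
          by (auto simp: diff_def[abs_def] intro!: derivative_eq_intros)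
      qed
    qed
    obtain t where t: "if 1 + x < 1 then 1 + x < t \<and> t < 1 else 1 < t \<and> t < 1 + x"
      and eq: "(1 + x) powr \<alpha> = (\<Sum>m<2. diff m 1 / fact m * (1 + x - 1) ^ m) + diff 2 t / fact 2 * (1 + x - 1) ^ 2"
      using Taylor[of 2 diff "\<lambda>t. t powr \<alpha>" "1/2" 2 1 "1 + x"] D False x
      by (auto simp: diff_def[abs_def])
    have rem: "(1 + x) powr \<alpha> - 1 - \<alpha> * x = \<alpha> * (\<alpha> - 1) * t powr (\<alpha> - 2) * x\<^sup>2 / 2"
      using eq by (simp add: diff_def numeral_2_eq_2)
    have "\<bar>(1 + x) powr \<alpha> - 1 - \<alpha> * x\<bar> = \<bar>\<alpha> * (\<alpha> - 1)\<bar> * t powr (\<alpha> - 2) * x\<^sup>2 / 2"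
      unfolding rem by (simp add: abs_mult)
    also have "\<dots> \<le> \<bar>\<alpha> * (\<alpha> - 1)\<bar> * t powr (\<alpha> - 2) * x\<^sup>2" by simp
    also have "\<dots> \<le> \<bar>\<alpha> * (\<alpha> - 1)\<bar> * K * x\<^sup>2"
      using t x by (intro mult_right_mono mult_left_mono K) (auto split: if_splits)
    finally show ?thesis .
  qed simp
qed

lemma powr_one_plus_linear:
  fixes \<alpha> :: real
  obtains C where "C \<ge> 0"
    and "\<And>x. - 1 / 2 \<le> x \<Longrightarrow> x \<le> 1 \<Longrightarrow> \<bar>(1 + x) powr \<alpha> - 1\<bar> \<le> C * \<bar>x\<bar>"
proof -
  obtain K where K: "K \<ge> 0"
    "\<And>x. - 1 / 2 \<le> x \<Longrightarrow> x \<le> 1 \<Longrightarrow> \<bar>(1 + x) powr \<alpha> - 1 - \<alpha> * x\<bar> \<le> K * x\<^sup>2"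
    by (rule powr_one_plus_quadratic[of \<alpha>]) blast
  have "\<bar>(1 + x) powr \<alpha> - 1\<bar> \<le> (K + \<bar>\<alpha>\<bar>) * \<bar>x\<bar>" if "- 1 / 2 \<le> x" "x \<le> 1" for x
  proof -
    have "x\<^sup>2 \<le> \<bar>x\<bar>"
      using that mult_right_mono[of "\<bar>x\<bar>" 1 "\<bar>x\<bar>"] by (simp add: power2_eq_square abs_le_iff)
    then have "K * x\<^sup>2 \<le> K * \<bar>x\<bar>" using K(1) by (rule mult_left_mono)
    moreover have "\<bar>\<alpha> * x\<bar> = \<bar>\<alpha>\<bar> * \<bar>x\<bar>" by (rule abs_mult)
    ultimately show ?thesis using K(2)[OF that] by (simp add: algebra_simps)
  qed
  then show thesis using that[of "K + \<bar>\<alpha>\<bar>"] K(1) by simp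
qed

text \<open>
  A state with \<open>i = l (1 - x) / 2\<close> and \<open>j = l (1 + x) / 2\<close> of an urn whose weights are exact powers has
  precisely this contrast as its drift: the factor \<open>l\<^sup>\<alpha>\<close> cancels.
\<close>
lemma powr_contrast_linearization:
  fixes \<alpha> :: real
  obtains C where "C \<ge> 0"
    and "\<And>x. \<bar>x\<bar> \<le> 1 / 2 \<Longrightarrow>
      \<bar>((1 - x) powr \<alpha> - (1 + x) powr \<alpha>) / ((1 - x) powr \<alpha> + (1 + x) powr \<alpha>) + \<alpha> * x\<bar> \<le> C * x\<^sup>2"
proof -
  obtain K where K: "K \<ge> 0"
    "\<And>x. - 1 / 2 \<le> x \<Longrightarrow> x \<le> 1 \<Longrightarrow> \<bar>(1 + x) powr \<alpha> - 1 - \<alpha> * x\<bar> \<le> K * x\<^sup>2"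
    by (rule powr_one_plus_quadratic[of \<alpha>]) blast
  define m where "m = min ((1/2) powr \<alpha>) 1"
  have m: "m > 0" by (simp add: m_def)
  have *: "\<bar>((1 - x) powr \<alpha> - (1 + x) powr \<alpha>) / ((1 - x) powr \<alpha> + (1 + x) powr \<alpha>) + \<alpha> * x\<bar>
      \<le> (2 * K + 2 * \<bar>\<alpha>\<bar> * K) / m * x\<^sup>2" if x: "\<bar>x\<bar> \<le> 1 / 2" for x
  proof -
    define p where "p = (1 + x) powr \<alpha>"
    define q where "q = (1 - x) powr \<alpha>"
    have p: "\<bar>p - 1 - \<alpha> * x\<bar> \<le> K * x\<^sup>2" using K(2)[of x] x by (simp add: p_def abs_le_iff)
    have q: "\<bar>q - 1 + \<alpha> * x\<bar> \<le> K * x\<^sup>2" using K(2)[of "-x"] x by (simp add: q_def abs_le_iff)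
    have pq: "p \<ge> 0" "q \<ge> 0" by (auto simp: p_def q_def)
    have ge: "p + q \<ge> m"
    proof (cases "\<alpha> \<ge> 0")
      case True
      then have "p \<ge> 1 \<or> q \<ge> 1"
        using ge_one_powr_ge_zero[of "1 + x" \<alpha>] ge_one_powr_ge_zero[of "1 - x" \<alpha>]
        by (cases "x \<ge> 0") (auto simp: p_def q_def)
      then show ?thesis using pq by (auto simp: m_def min_def)
    next
      case False
      then have "p \<ge> 1 \<or> q \<ge> 1"
        using powr_mono2'[of \<alpha> "1 + x" 1] powr_mono2'[of \<alpha> "1 - x" 1] x
        by (cases "x \<ge> 0") (auto simp: p_def q_def abs_le_iff)
      then show ?thesis using pq by (auto simp: m_def min_def)
    qed
    have "\<bar>\<alpha> * x\<bar> \<le> \<bar>\<alpha>\<bar>" using x mult_left_mono[of "\<bar>x\<bar>" 1 "\<bar>\<alpha>\<bar>"] by (simp add: abs_mult)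
    then have r: "\<bar>\<alpha> * x * ((p - 1 - \<alpha> * x) + (q - 1 + \<alpha> * x))\<bar> \<le> \<bar>\<alpha>\<bar> * (2 * (K * x\<^sup>2))"
      unfolding abs_mult[of "\<alpha> * x"] using p q by (intro mult_mono) auto
    have "(q - p) + \<alpha> * x * (p + q)
        = (q - 1 + \<alpha> * x) - (p - 1 - \<alpha> * x) + \<alpha> * x * ((p - 1 - \<alpha> * x) + (q - 1 + \<alpha> * x))"
      by (simp add: algebra_simps)
    then have num: "\<bar>(q - p) + \<alpha> * x * (p + q)\<bar> \<le> (2 * K + 2 * \<bar>\<alpha>\<bar> * K) * x\<^sup>2"
      using p q r by (simp add: algebra_simps)
    have pos: "p + q > 0" using ge m by simp
    have "(q - p) / (q + p) + \<alpha> * x = ((q - p) + \<alpha> * x * (p + q)) / (p + q)"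
      using pos by (simp add: field_simps)
    then have "\<bar>(q - p) / (q + p) + \<alpha> * x\<bar> = \<bar>(q - p) + \<alpha> * x * (p + q)\<bar> / (p + q)"
      using pos by simp
    also have "\<dots> \<le> (2 * K + 2 * \<bar>\<alpha>\<bar> * K) * x\<^sup>2 / m"
      using num ge m by (intro frac_le) auto
    finally show ?thesis by (simp add: p_def q_def)
  qed
  have "(2 * K + 2 * \<bar>\<alpha>\<bar> * K) / m \<ge> 0" using K(1) m by simp
  then show thesis using that[OF _ *] by blast
qed

text \<open>
  Relative errors in the two reciprocal weights move the drift by at most the difference of these
  errors: the change is \<open>2 a c (e - e') / ((a + c) (a (1 + e) + c (1 + e')))\<close>, where \<open>4 a c \<le> (a + c)\<^sup>2\<close>.
\<close>
lemma contrast_perturbation: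
  fixes a c e e' :: real
  assumes "a > 0" "c > 0" "\<bar>e\<bar> \<le> 1 / 2" "\<bar>e'\<bar> \<le> 1 / 2"
  shows "\<bar>(a * (1 + e) - c * (1 + e')) / (a * (1 + e) + c * (1 + e')) - (a - c) / (a + c)\<bar> \<le> \<bar>e - e'\<bar>"
proof -
  have g: "a * (1 + e) + c * (1 + e') \<ge> (a + c) / 2"
  proof -
    have "a * (1 / 2) \<le> a * (1 + e)" "c * (1 / 2) \<le> c * (1 + e')"
      using assms by (auto intro!: mult_left_mono simp: abs_le_iff)
    then show ?thesis by simp
  qed
  have pos: "a + c > 0" "a * (1 + e) + c * (1 + e') > 0" using g assms by auto
  have "(a * (1 + e) - c * (1 + e')) / (a * (1 + e) + c * (1 + e')) - (a - c) / (a + c)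
      = 2 * a * c * (e - e') / ((a * (1 + e) + c * (1 + e')) * (a + c))"
    using pos by (simp add: divide_simps) (simp add: algebra_simps)
  then have "\<bar>(a * (1 + e) - c * (1 + e')) / (a * (1 + e) + c * (1 + e')) - (a - c) / (a + c)\<bar>
      = 2 * a * c * \<bar>e - e'\<bar> / ((a * (1 + e) + c * (1 + e')) * (a + c))"
    using pos assms by (simp add: abs_mult)
  also have "\<dots> \<le> 2 * a * c * \<bar>e - e'\<bar> / ((a + c) / 2 * (a + c))"
    using g pos assms by (intro divide_left_mono mult_right_mono) auto
  also have "\<dots> = (4 * a * c / (a + c)\<^sup>2) * \<bar>e - e'\<bar>"
    by (simp add: power2_eq_square)
  also have "\<dots> \<le> 1 * \<bar>e - e'\<bar>"
  proof (intro mult_right_mono)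
    have "4 * a * c \<le> (a + c)\<^sup>2" using zero_le_power2[of "a - c"] by (simp add: power2_eq_square algebra_simps)
    then show "4 * a * c / (a + c)\<^sup>2 \<le> 1" using pos by simp
  qed simp
  finally show ?thesis by simp
qed

text \<open>
  By the mean value theorem each term differs from the integral over its unit interval by at most the
  increment of the integrand there, and these increments telescope.
\<close>
lemma power_sum_integral_comparison:
  fixes \<beta> :: real
  assumes "\<beta> \<ge> 0" "1 \<le> k" "k \<le> m"
  shows "\<bar>(\<Sum>l=k..<m. real (Suc l) powr \<beta>) - (real m powr (\<beta> + 1) - real k powr (\<beta> + 1)) / (\<beta> + 1)\<bar>
     \<le> real m powr \<beta>"
proof -
  define F where "F l = real l powr (\<beta> + 1) / (\<beta> + 1)" for l :: nat
  have step: "real l powr \<beta> \<le> F (Suc l) - F l \<and> F (Suc l) - F l \<le> real (Suc l) powr \<beta>" if "l \<ge> 1" for l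
  proof -
    have "\<exists>z. real l < z \<and> z < real (Suc l) \<and> (\<lambda>z. z powr (\<beta> + 1) / (\<beta> + 1)) (real (Suc l)) - (\<lambda>z. z powr (\<beta> + 1) / (\<beta> + 1)) (real l)
        = (real (Suc l) - real l) * (\<lambda>z. z powr \<beta>) z"
    proof (rule MVT2)
      fix z assume "real l \<le> z"
      then show "((\<lambda>z. z powr (\<beta> + 1) / (\<beta> + 1)) has_real_derivative z powr \<beta>) (at z)"
        using that assms(1) by (auto intro!: derivative_eq_intros)
    qed simp
    then obtain z where z: "real l < z" "z < real (Suc l)" "F (Suc l) - F l = z powr \<beta>"
      by (auto simp: F_def)
    then show ?thesis using assms(1) by (auto intro!: powr_mono2)
  qed
  have tele: "(\<Sum>l=k..<m. F (Suc l) - F l) = F m - F k"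
    using assms(3) by (rule sum_Suc_diff')
  have "(\<Sum>l=k..<m. F (Suc l) - F l) \<le> (\<Sum>l=k..<m. real (Suc l) powr \<beta>)"
    using step assms(2) by (intro sum_mono) auto
  moreover have "(\<Sum>l=k..<m. real (Suc l) powr \<beta>) - (\<Sum>l=k..<m. F (Suc l) - F l)
      \<le> (\<Sum>l=k..<m. real (Suc l) powr \<beta> - real l powr \<beta>)"
    unfolding sum_subtractf[symmetric]
  proof (rule sum_mono)
    fix l assume "l \<in> {k..<m}"
    then have "real l powr \<beta> \<le> F (Suc l) - F l" using step[of l] assms(2) by simp
    then show "real (Suc l) powr \<beta> - (F (Suc l) - F l) \<le> real (Suc l) powr \<beta> - real l powr \<beta>" by linarith
  qed
  moreover have "(\<Sum>l=k..<m. real (Suc l) powr \<beta> - real l powr \<beta>) = real m powr \<beta> - real k powr \<beta>"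
    using assms(3) by (rule sum_Suc_diff')
  moreover have "real k powr \<beta> \<ge> 0" "F m - F k = (real m powr (\<beta> + 1) - real k powr (\<beta> + 1)) / (\<beta> + 1)"
    by (auto simp: F_def diff_divide_distrib)
  ultimately show ?thesis unfolding tele by linarith
qed

lemma integral_powr_interval:
  fixes a c \<beta> :: real
  assumes "0 < a" "a \<le> c" "\<beta> \<ge> 0"
  shows "integral {a..c} (\<lambda>u. u powr \<beta>) = (c powr (\<beta> + 1) - a powr (\<beta> + 1)) / (\<beta> + 1)"
proof -
  have "((\<lambda>u. u powr \<beta>) has_integral (c powr (\<beta> + 1) / (\<beta> + 1) - a powr (\<beta> + 1) / (\<beta> + 1))) {a..c}"
  proof (rule fundamental_theorem_of_calculus[OF assms(2)])
    fix u assume "u \<in> {a..c}"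
    then have "((\<lambda>u. u powr (\<beta> + 1) / (\<beta> + 1)) has_real_derivative u powr \<beta>) (at u within {a..c})"
      using assms by (auto intro!: derivative_eq_intros)
    then show "((\<lambda>u. u powr (\<beta> + 1) / (\<beta> + 1)) has_vector_derivative u powr \<beta>) (at u within {a..c})"
      by (simp add: has_real_derivative_iff_has_vector_derivative)
  qed
  then show ?thesis by (simp add: integral_unique diff_divide_distrib)
qed

section \<open>The drift of an urn with power-law weights\<close>

text \<open>
  The factor 2 is kept because the urns sample \<open>w\<close> at even or at odd arguments. It cancels in the drift,
  but with it the even and the odd subsequence meet the same normalisation.
\<close>
definition power_weight :: "real \<Rightarrow> (nat \<Rightarrow> real) \<Rightarrow> bool" where
  "power_weight \<alpha> b \<longleftrightarrow> (\<forall>i. b i > 0) \<and>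
     (\<exists>K. \<forall>i\<ge>1. \<bar>1 / (b i * real (2 * i) powr \<alpha>) - 1\<bar> \<le> K / real i)"

lemma bound_of_eventual_bound:
  fixes f :: "nat \<Rightarrow> real"
  assumes "\<And>i. i \<ge> N \<Longrightarrow> f i \<le> K / real i"
  shows "\<exists>K. \<forall>i\<ge>1. f i \<le> K / real i"
proof (intro exI allI impI)
  fix i :: nat assume i: "i \<ge> 1"
  define K' where "K' = \<bar>K\<bar> + (\<Sum>j<N. \<bar>real j * f j\<bar>)"
  have "real i * f i \<le> K'"
  proof (cases "i < N")
    case True
    then have "\<bar>real i * f i\<bar> \<le> (\<Sum>j<N. \<bar>real j * f j\<bar>)"
      by (intro member_le_sum) auto
    then show ?thesis by (simp add: K'_def)
  next
    case False
    then have "real i * f i \<le> K" using assms[of i] i by (simp add: field_simps)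
    moreover have "(\<Sum>j<N. \<bar>real j * f j\<bar>) \<ge> 0" by (intro sum_nonneg) auto
    ultimately show ?thesis unfolding K'_def by linarith
  qed
  then show "f i \<le> K' / real i" using i by (simp add: field_simps)
qed

text \<open>
  Passing from \<open>2 i\<close> to \<open>2 i + 1\<close> multiplies the power by \<open>1 + O(1/i)\<close>, so the three types of urn differ
  only within the error term.
\<close>
lemma power_weight_subsequence:
  fixes \<alpha> B :: real and w :: "nat \<Rightarrow> real"
  assumes pos: "\<And>n. w n > 0" and c: "c \<le> 1"
    and E: "E \<in> O(\<lambda>n. 1 / (real n)\<^sup>2)"
    and ev: "\<forall>\<^sub>F n in sequentially. 1 / w n = real n powr \<alpha> * (1 + 2 * B / real n + E n)"
  shows "power_weight \<alpha> (\<lambda>i. w (2 * i + c))"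
proof -
  obtain Q where Q: "Q > 0" "\<forall>\<^sub>F n in sequentially. norm (E n) \<le> Q * norm (1 / (real n)\<^sup>2)"
    using landau_o.bigE[OF E] by blast
  obtain N where N: "\<And>n. n \<ge> N \<Longrightarrow> 1 / w n = real n powr \<alpha> * (1 + 2 * B / real n + E n)
      \<and> \<bar>E n\<bar> \<le> Q * (1 / (real n)\<^sup>2)"
    using eventually_conj[OF ev Q(2)] by (auto simp: eventually_sequentially)
  obtain C where C: "C \<ge> 0" "\<And>x. - 1 / 2 \<le> x \<Longrightarrow> x \<le> 1 \<Longrightarrow> \<bar>(1 + x) powr \<alpha> - 1\<bar> \<le> C * \<bar>x\<bar>"
    by (rule powr_one_plus_linear[of \<alpha>]) blast
  define P where "P = 2 * \<bar>B\<bar> + Q"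
  have P: "P \<ge> 0" using Q by (simp add: P_def)
  have bnd: "\<bar>1 / (w (2 * i + c) * real (2 * i) powr \<alpha>) - 1\<bar> \<le> (P + C + C * P) / real i"
    if i: "i \<ge> max 1 N" for i
  proof -
    define n where "n = 2 * i + c"
    define y where "y = real c / real (2 * i)"
    have n: "n \<ge> N" "n \<ge> i" "real i \<ge> 1" "real n \<ge> real i" using i by (auto simp: n_def)
    define e where "e = 2 * B / real n + E n"
    define f where "f = (1 + y) powr \<alpha> - 1"
    have "real i * 1 \<le> real n * real n" using n by (intro mult_mono) auto
    then have "1 / (real n)\<^sup>2 \<le> 1 / real i" using n by (intro frac_le) (auto simp: power2_eq_square)
    then have "Q * (1 / (real n)\<^sup>2) \<le> Q * (1 / real i)" using Q(1) by (intro mult_left_mono) auto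
    then have "\<bar>E n\<bar> \<le> Q / real i" using conjunct2[OF N[OF n(1)]] by simp
    moreover have "\<bar>2 * B / real n\<bar> \<le> 2 * \<bar>B\<bar> / real i"
      using n by (simp add: frac_le abs_mult)
    ultimately have e: "\<bar>e\<bar> \<le> P / real i" unfolding e_def P_def add_divide_distrib by linarith
    have y: "0 \<le> y" "y \<le> 1 / real i" "y \<le> 1"
      using c n by (auto simp: y_def field_simps)
    have "\<bar>f\<bar> \<le> C * y" using C(2)[of y] y by (simp add: f_def)
    also have "\<dots> \<le> C * (1 / real i)" using C(1) y by (intro mult_left_mono)
    finally have f: "\<bar>f\<bar> \<le> C / real i" by simp
    have "real n = real (2 * i) * (1 + y)" using n by (simp add: n_def y_def field_simps)
    then have "real n powr \<alpha> = real (2 * i) powr \<alpha> * (1 + f)"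
      using y by (simp add: powr_mult f_def)
    then have eq: "1 / w n = real (2 * i) powr \<alpha> * (1 + f) * (1 + e)"
      using conjunct1[OF N[OF n(1)]] by (simp only: e_def add.assoc)
    have "1 / (w n * real (2 * i) powr \<alpha>) = (1 / w n) / real (2 * i) powr \<alpha>" by simp
    also have "\<dots> = (1 + f) * (1 + e)" unfolding eq using n by simp
    finally have "1 / (w n * real (2 * i) powr \<alpha>) = (1 + f) * (1 + e)" .
    then have "\<bar>1 / (w n * real (2 * i) powr \<alpha>) - 1\<bar> = \<bar>e + f + f * e\<bar>" by (simp add: algebra_simps)
    also have "\<dots> \<le> \<bar>e\<bar> + \<bar>f\<bar> + \<bar>f\<bar> * \<bar>e\<bar>"
      unfolding abs_mult[symmetric] by linarith
    also have "\<bar>f\<bar> * \<bar>e\<bar> \<le> C / real i * P"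
    proof (intro mult_mono f)
      have "P / real i \<le> P / 1" using P n by (intro divide_left_mono) auto
      then show "\<bar>e\<bar> \<le> P" using e by linarith
    qed (use C n in auto)
    finally show ?thesis using e f by (simp add: n_def add_divide_distrib)
  qed
  show ?thesis unfolding power_weight_def
    using pos bound_of_eventual_bound[of "max 1 N", OF bnd] by blast
qed

definition drift :: "(nat \<Rightarrow> real) \<Rightarrow> (nat \<Rightarrow> real) \<Rightarrow> nat \<times> nat \<Rightarrow> real" where
  "drift b r s = (r (snd s) - b (fst s)) / (b (fst s) + r (snd s))"

lemma abs_drift_le_1:
  assumes "\<And>i. b i > 0" "\<And>j. r j > 0"
  shows "\<bar>drift b r s\<bar> \<le> 1"
  using assms[of "fst s"] assms(2)[of "snd s"] by (simp add: drift_def abs_le_iff field_simps)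

text \<open>
  If \<open>x\<close> is not near 0 or \<open>l\<close> is below a constant, the right-hand side exceeds the trivial bound
  \<open>1 + \<bar>\<alpha>\<bar>\<close>. Otherwise both colours have been drawn at least \<open>l / 4\<close> times, so both relative errors of
  the weights are \<open>O(1/l)\<close> and the expansion of the exact power law applies.
\<close>
lemma drift_linearization:
  assumes b: "power_weight \<alpha> b" and r: "power_weight \<alpha> r"
  obtains C where "C \<ge> 0"
    and "\<And>i j l x. l = i + j \<Longrightarrow> l \<ge> 1 \<Longrightarrow> x = (real j - real i) / real l \<Longrightarrow>
       \<bar>drift b r (i, j) + \<alpha> * x\<bar> \<le> C * (x\<^sup>2 + 1 / real l)"
proof -
  obtain Kb where Kb: "\<And>i. i \<ge> 1 \<Longrightarrow> \<bar>1 / (b i * real (2 * i) powr \<alpha>) - 1\<bar> \<le> Kb / real i"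
    using b by (auto simp: power_weight_def)
  obtain Kr where Kr: "\<And>i. i \<ge> 1 \<Longrightarrow> \<bar>1 / (r i * real (2 * i) powr \<alpha>) - 1\<bar> \<le> Kr / real i"
    using r by (auto simp: power_weight_def)
  define K where "K = \<bar>Kb\<bar> + \<bar>Kr\<bar>"
  have K: "K \<ge> 0" "Kb \<le> K" "Kr \<le> K" by (auto simp: K_def)
  obtain A where A: "A \<ge> 0" "\<And>x. \<bar>x\<bar> \<le> 1 / 2 \<Longrightarrow>
      \<bar>((1 - x) powr \<alpha> - (1 + x) powr \<alpha>) / ((1 - x) powr \<alpha> + (1 + x) powr \<alpha>) + \<alpha> * x\<bar> \<le> A * x\<^sup>2"
    by (rule powr_contrast_linearization[of \<alpha>]) blast
  have pos: "b i > 0" "r i > 0" for i using b r by (auto simp: power_weight_def)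
  define C where "C = A + 8 * K + 4 * (1 + \<bar>\<alpha>\<bar>) + 8 * K * (1 + \<bar>\<alpha>\<bar>)"
  have C: "C \<ge> 0" "A \<le> C" "8 * K \<le> C" "4 * (1 + \<bar>\<alpha>\<bar>) \<le> C" "8 * K * (1 + \<bar>\<alpha>\<bar>) \<le> C"
    using A(1) K by (auto simp: C_def)
  have "\<bar>drift b r (i, j) + \<alpha> * x\<bar> \<le> C * (x\<^sup>2 + 1 / real l)"
    if l: "l = i + j" "l \<ge> 1" and x: "x = (real j - real i) / real l" for i j l x
  proof -
    have l1: "real l \<ge> 1" using l by simp
    have x1: "\<bar>x\<bar> \<le> 1" using l by (auto simp: x abs_le_iff field_simps)
    have triv: "\<bar>drift b r (i, j) + \<alpha> * x\<bar> \<le> 1 + \<bar>\<alpha>\<bar>"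
    proof -
      have "\<bar>\<alpha> * x\<bar> \<le> \<bar>\<alpha>\<bar>" using x1 mult_left_mono[of "\<bar>x\<bar>" 1 "\<bar>\<alpha>\<bar>"] by (simp add: abs_mult)
      moreover have "\<bar>drift b r (i, j)\<bar> \<le> 1" by (rule abs_drift_le_1) (auto simp: pos)
      ultimately show ?thesis by linarith
    qed
    consider "\<bar>x\<bar> > 1 / 2" | "real l < 8 * K" | "\<bar>x\<bar> \<le> 1 / 2" "real l \<ge> 8 * K" by linarith
    then show ?thesis
    proof cases
      case 1
      have "(1 / 2) * (1 / 2) \<le> \<bar>x\<bar> * \<bar>x\<bar>" using 1 by (intro mult_mono) auto
      then have "1 + \<bar>\<alpha>\<bar> \<le> 4 * (1 + \<bar>\<alpha>\<bar>) * x\<^sup>2"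
        using mult_left_mono[of "1/4" "x\<^sup>2" "4 * (1 + \<bar>\<alpha>\<bar>)"] by (simp add: power2_eq_square)
      also have "\<dots> \<le> C * (x\<^sup>2 + 1 / real l)" using C l1 by (intro mult_mono) auto
      finally show ?thesis using triv by linarith
    next
      case 2
      have "1 + \<bar>\<alpha>\<bar> \<le> 8 * K * (1 + \<bar>\<alpha>\<bar>) * (1 / real l)"
        using 2 l1 mult_right_mono[of "real l" "8 * K" "1 + \<bar>\<alpha>\<bar>"] by (simp add: field_simps)
      also have "\<dots> \<le> C * (x\<^sup>2 + 1 / real l)" using C l1 by (intro mult_mono) auto
      finally show ?thesis using triv by linarith
    next
      case 3
      have ij: "2 * real i = real l * (1 - x)" "2 * real j = real l * (1 + x)"
        using l l1 by (auto simp: x field_simps)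
      have "real l * (1/2) \<le> real l * (1 - x)" "real l * (1/2) \<le> real l * (1 + x)"
        using 3 l1 by (auto intro!: mult_left_mono)
      then have ge: "real i \<ge> real l / 4" "real j \<ge> real l / 4" using ij by auto
      then have i1: "i \<ge> 1" "j \<ge> 1" using l1 by (auto simp: Suc_le_eq intro!: Nat.gr0I)
      define e where "e = 1 / (b i * real (2 * i) powr \<alpha>) - 1"
      define e' where "e' = 1 / (r j * real (2 * j) powr \<alpha>) - 1"
      have "\<bar>e\<bar> \<le> K / real i"
        using Kb[OF i1(1)] divide_right_mono[OF K(2), of "real i"] by (simp add: e_def)
      also have "\<dots> \<le> K / (real l / 4)" using K ge l1 by (intro divide_left_mono) auto
      finally have e: "\<bar>e\<bar> \<le> 4 * K / real l" by (simp add: mult.commute)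
      have "\<bar>e'\<bar> \<le> K / real j"
        using Kr[OF i1(2)] divide_right_mono[OF K(3), of "real j"] by (simp add: e'_def)
      also have "\<dots> \<le> K / (real l / 4)" using K ge l1 by (intro divide_left_mono) auto
      finally have e': "\<bar>e'\<bar> \<le> 4 * K / real l" by (simp add: mult.commute)
      have half: "4 * K / real l \<le> 1 / 2" using 3 l1 by (simp add: field_simps)
      define a where "a = (1 - x) powr \<alpha>"
      define c where "c = (1 + x) powr \<alpha>"
      have ac: "a > 0" "c > 0" using 3 by (auto simp: a_def c_def)
      have bi: "1 / b i = real l powr \<alpha> * (a * (1 + e))"
      proof -
        have "real (2 * i) powr \<alpha> = real l powr \<alpha> * a"
          using ij 3 by (simp add: a_def powr_mult)
        moreover have "real (2 * i) powr \<alpha> > 0" using i1 by simp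
        ultimately show ?thesis using pos[of i] ac l1 by (simp add: e_def field_simps)
      qed
      have rj: "1 / r j = real l powr \<alpha> * (c * (1 + e'))"
      proof -
        have "real (2 * j) powr \<alpha> = real l powr \<alpha> * c"
          using ij 3 by (simp add: c_def powr_mult)
        moreover have "real (2 * j) powr \<alpha> > 0" using i1 by simp
        ultimately show ?thesis using pos[of j] ac l1 by (simp add: e'_def field_simps)
      qed
      have "drift b r (i, j) = (1 / b i - 1 / r j) / (1 / b i + 1 / r j)"
      proof -
        have "1 / b i - 1 / r j = (r j - b i) / (b i * r j)" "1 / b i + 1 / r j = (b i + r j) / (b i * r j)"
          using pos[of i] pos[of j] by (simp_all add: field_simps)
        then show ?thesis using pos[of i] pos[of j] by (simp add: drift_def)
      qed
      also have "\<dots> = (real l powr \<alpha> * (a * (1 + e) - c * (1 + e')))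
          / (real l powr \<alpha> * (a * (1 + e) + c * (1 + e')))"
        unfolding bi rj by (simp add: algebra_simps)
      also have "\<dots> = (a * (1 + e) - c * (1 + e')) / (a * (1 + e) + c * (1 + e'))"
        using l1 by simp
      finally have "\<bar>drift b r (i, j) - (a - c) / (a + c)\<bar> \<le> \<bar>e - e'\<bar>"
        using contrast_perturbation[OF ac, of e e'] e e' half by simp
      moreover have "\<bar>(a - c) / (a + c) + \<alpha> * x\<bar> \<le> A * x\<^sup>2" using A(2)[of x] 3 by (simp add: a_def c_def)
      moreover have "\<bar>e - e'\<bar> \<le> 8 * K * (1 / real l)" using e e' by simp
      moreover have "A * x\<^sup>2 \<le> C * x\<^sup>2" using C by (intro mult_right_mono) auto
      moreover have "8 * K * (1 / real l) \<le> C * (1 / real l)" using C l1 by (intro mult_right_mono) auto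
      ultimately show ?thesis unfolding distrib_left by linarith
    qed
  qed
  then show thesis using that[OF C(1)] by blast
qed

text \<open>
  Far from the diagonal the colour drawn more often has the smaller weight. If \<open>j\<close> is large, both weights
  are close to their power laws, which differ at least by the factor \<open>(1 + \<epsilon>)\<^sup>\<alpha>\<close>; the finitely many
  remaining \<open>j\<close> are covered because \<open>b i\<close> tends to 0.
\<close>
lemma power_weight_unbalanced:
  assumes b: "power_weight \<alpha> b" and r: "power_weight \<alpha> r" and \<alpha>: "\<alpha> > 0" and \<epsilon>: "\<epsilon> > 0"
  obtains L :: nat where "\<And>i j. i + j \<ge> L \<Longrightarrow> real i \<ge> (1 + \<epsilon>) * real j \<Longrightarrow> b i \<le> r j"
proof -
  obtain Kb where Kb: "\<And>i. i \<ge> 1 \<Longrightarrow> \<bar>1 / (b i * real (2 * i) powr \<alpha>) - 1\<bar> \<le> Kb / real i"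
    using b by (auto simp: power_weight_def)
  obtain Kr where Kr: "\<And>i. i \<ge> 1 \<Longrightarrow> \<bar>1 / (r i * real (2 * i) powr \<alpha>) - 1\<bar> \<le> Kr / real i"
    using r by (auto simp: power_weight_def)
  have pos: "b i > 0" "r i > 0" for i using b r by (auto simp: power_weight_def)
  define q where "q = (1 + \<epsilon>) powr \<alpha>"
  have q: "q > 1" using \<alpha> \<epsilon> by (simp add: q_def)
  \<comment> \<open>the relative error that the gap \<open>q\<close> between the two power laws can absorb:
      \<open>q (1 - \<eta>) = 1 + \<eta>\<close>\<close>
  define \<eta> where "\<eta> = (q - 1) / (q + 1)"
  have \<eta>: "\<eta> > 0" "q * (1 - \<eta>) = 1 + \<eta>" "\<eta> < 1" using q by (auto simp: \<eta>_def field_simps)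
  have "\<forall>\<^sub>F i in sequentially. Kb / real i < \<eta> \<and> Kr / real i < \<eta> \<and> i \<ge> 1"
    using \<eta>(1) by (intro eventually_conj order_tendstoD[OF lim_const_over_n] eventually_ge_at_top) auto
  then obtain N where N: "\<And>i. i \<ge> N \<Longrightarrow> Kb / real i < \<eta> \<and> Kr / real i < \<eta> \<and> i \<ge> 1"
    by (auto simp: eventually_sequentially)
  have lower: "(1 - \<eta>) * real (2 * i) powr \<alpha> \<le> 1 / b i" if "i \<ge> N" for i
  proof -
    have "1 - \<eta> \<le> 1 / (b i * real (2 * i) powr \<alpha>)"
      using Kb[of i] N[OF that] by (auto simp: abs_le_iff)
    then show ?thesis using pos[of i] N[OF that] by (simp add: field_simps)
  qed
  have upper: "1 / r i \<le> (1 + \<eta>) * real (2 * i) powr \<alpha>" if "i \<ge> N" for i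
  proof -
    have "1 / (r i * real (2 * i) powr \<alpha>) \<le> 1 + \<eta>"
      using Kr[of i] N[OF that] by (auto simp: abs_le_iff)
    then show ?thesis using pos[of i] N[OF that] by (simp add: field_simps)
  qed
  define T where "T = (\<Sum>j<N. 1 / r j)"
  have "filterlim (\<lambda>i. (1 - \<eta>) * real (2 * i) powr \<alpha>) at_top sequentially"
    using \<alpha> \<eta>(3) by real_asymp
  then have "\<forall>\<^sub>F i in sequentially. T \<le> (1 - \<eta>) * real (2 * i) powr \<alpha>"
    by (simp add: filterlim_at_top)
  then obtain N' where N': "\<And>i. i \<ge> N' \<Longrightarrow> T \<le> (1 - \<eta>) * real (2 * i) powr \<alpha>"
    by (auto simp: eventually_sequentially)
  have "b i \<le> r j" if l: "i + j \<ge> 2 * (N + N')" and ij: "real i \<ge> (1 + \<epsilon>) * real j" for i j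
  proof -
    have "real i \<ge> real j" using ij \<epsilon> mult_right_mono[of 1 "1 + \<epsilon>" "real j"] by linarith
    then have i: "i \<ge> N" "i \<ge> N'" using l by auto
    have "1 / r j \<le> 1 / b i"
    proof (cases "j \<ge> N")
      case True
      have "1 / r j \<le> (1 - \<eta>) * (q * real (2 * j) powr \<alpha>)"
        using upper[OF True] unfolding \<eta>(2)[symmetric] by (simp only: ac_simps)
      also have "q * real (2 * j) powr \<alpha> = ((1 + \<epsilon>) * real (2 * j)) powr \<alpha>"
        using \<epsilon> by (simp add: q_def powr_mult)
      also have "(1 - \<eta>) * \<dots> \<le> (1 - \<eta>) * real (2 * i) powr \<alpha>"
        using ij \<eta>(3) \<alpha> \<epsilon> by (intro mult_left_mono powr_mono2) auto
      also have "\<dots> \<le> 1 / b i" by (rule lower[OF i(1)])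
      finally show ?thesis .
    next
      case False
      have "1 / r j \<le> T"
        unfolding T_def using False pos(2) by (intro member_le_sum) (auto intro: less_imp_le)
      then show ?thesis using N'[OF i(2)] lower[OF i(1)] by linarith
    qed
    then show ?thesis using pos[of i] pos[of j] by (simp add: field_simps)
  qed
  then show thesis using that by blast
qed

text \<open>
  A bound on the product, and not only on the drift, is what closes the moment recursions. For
  \<open>\<bar>D\<bar> \<le> \<epsilon> l\<close> the term \<open>-\<alpha> D\<^sup>2 / l\<close> dominates the quadratic error of the expansion as soon as
  \<open>A \<epsilon> \<le> \<alpha>\<close>; for larger \<open>\<bar>D\<bar>\<close> the drift has the sign opposite to \<open>D\<close>.
\<close>
lemma drift_restoring:
  assumes b: "power_weight \<alpha> b" and r: "power_weight \<alpha> r" and \<alpha>: "\<alpha> > 0"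
  obtains C where "C \<ge> 0" and "\<And>i j. (real j - real i) * drift b r (i, j) \<le> C"
proof -
  obtain A where A: "A \<ge> 0"
    "\<And>i j l x. l = i + j \<Longrightarrow> l \<ge> 1 \<Longrightarrow> x = (real j - real i) / real l \<Longrightarrow>
       \<bar>drift b r (i, j) + \<alpha> * x\<bar> \<le> A * (x\<^sup>2 + 1 / real l)"
    by (rule drift_linearization[OF b r]) blast
  have pos: "b i > 0" "r i > 0" for i using b r by (auto simp: power_weight_def)
  define \<epsilon> where "\<epsilon> = \<alpha> / (A + 1)"
  have \<epsilon>: "\<epsilon> > 0" "A * \<epsilon> \<le> \<alpha>" using \<alpha> A(1) by (auto simp: \<epsilon>_def field_simps)
  obtain L where L: "\<And>i j. i + j \<ge> L \<Longrightarrow> real i \<ge> (1 + \<epsilon>) * real j \<Longrightarrow> b i \<le> r j"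
    by (rule power_weight_unbalanced[OF b r \<alpha> \<epsilon>(1)]) blast
  obtain L' where L': "\<And>i j. i + j \<ge> L' \<Longrightarrow> real i \<ge> (1 + \<epsilon>) * real j \<Longrightarrow> r i \<le> b j"
    by (rule power_weight_unbalanced[OF r b \<alpha> \<epsilon>(1)]) blast
  define N where "N = 1 + L + L'"
  define C where "C = A + real N"
  have C: "C \<ge> 0" using A(1) by (simp add: C_def)
  have "(real j - real i) * drift b r (i, j) \<le> C" for i j
  proof -
    define l where "l = i + j"
    define D where "D = real j - real i"
    have D: "\<bar>D\<bar> \<le> real l" by (auto simp: D_def l_def)
    have d1: "\<bar>drift b r (i, j)\<bar> \<le> 1" by (rule abs_drift_le_1) (auto simp: pos)
    have sum_pos: "b i + r j > 0" using pos[of i] pos[of j] by simp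
    consider "l < N" | "l \<ge> N" "\<bar>D\<bar> \<le> \<epsilon> * real l"
      | "l \<ge> N" "D > \<epsilon> * real l" | "l \<ge> N" "- D > \<epsilon> * real l" by linarith
    then show ?thesis
    proof cases
      case 1
      have "D * drift b r (i, j) \<le> \<bar>D\<bar> * \<bar>drift b r (i, j)\<bar>" by (simp add: abs_mult[symmetric])
      also have "\<dots> \<le> \<bar>D\<bar> * 1" using d1 by (intro mult_left_mono) auto
      also have "\<dots> \<le> real N" using 1 D by simp
      finally show ?thesis using A(1) by (simp add: C_def D_def)
    next
      case 2
      then have l1: "real l \<ge> 1" by (simp add: N_def)
      define x where "x = D / real l"
      have "\<bar>x\<bar> = \<bar>D\<bar> / real l" by (simp add: x_def)
      then have x: "\<bar>x\<bar> \<le> \<epsilon>" "\<bar>x\<bar> \<le> 1" "D = x * real l"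
        using 2(2) l1 D by (simp_all add: divide_le_eq x_def)
      have "\<bar>drift b r (i, j) + \<alpha> * x\<bar> \<le> A * (x\<^sup>2 + 1 / real l)"
        using A(2)[of l i j x] l1 by (simp add: x_def D_def l_def)
      then have "\<bar>x * (drift b r (i, j) + \<alpha> * x)\<bar> \<le> \<bar>x\<bar> * (A * (x\<^sup>2 + 1 / real l))"
        unfolding abs_mult by (intro mult_left_mono) auto
      then have "x * (drift b r (i, j) + \<alpha> * x) \<le> \<bar>x\<bar> * (A * (x\<^sup>2 + 1 / real l))" by linarith
      also have "\<dots> = (A * \<bar>x\<bar>) * x\<^sup>2 + \<bar>x\<bar> * (A / real l)" by (simp add: algebra_simps)
      also have "\<dots> \<le> \<alpha> * x\<^sup>2 + 1 * (A / real l)"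
      proof (intro add_mono mult_right_mono)
        show "A * \<bar>x\<bar> \<le> \<alpha>" using x(1) \<epsilon>(2) A(1) mult_left_mono[of "\<bar>x\<bar>" \<epsilon> A] by linarith
      qed (use x A l1 in auto)
      finally have "x * drift b r (i, j) \<le> A / real l" by (simp add: algebra_simps power2_eq_square)
      then have "real l * (x * drift b r (i, j)) \<le> A" using l1 by (simp add: field_simps)
      then have "D * drift b r (i, j) \<le> A" unfolding x(3) by (simp only: ac_simps)
      then show ?thesis by (simp add: C_def D_def)
    next
      case 3
      have "\<epsilon> * real i \<le> \<epsilon> * real l" using \<epsilon>(1) by (intro mult_left_mono) (auto simp: l_def)
      then have "real j \<ge> (1 + \<epsilon>) * real i" using 3(2) unfolding D_def distrib_right by linarith
      then have "r j \<le> b i" using 3(1) by (intro L') (auto simp: N_def l_def)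
      then have "drift b r (i, j) \<le> 0" using sum_pos by (simp add: drift_def divide_le_0_iff)
      moreover have "0 \<le> \<epsilon> * real l" using \<epsilon>(1) by simp
      ultimately have "D * drift b r (i, j) \<le> 0" using 3(2) by (intro mult_nonneg_nonpos) auto
      then show ?thesis using C by (simp add: D_def)
    next
      case 4
      have "\<epsilon> * real j \<le> \<epsilon> * real l" using \<epsilon>(1) by (intro mult_left_mono) (auto simp: l_def)
      then have "real i \<ge> (1 + \<epsilon>) * real j" using 4(2) unfolding D_def distrib_right by linarith
      then have "b i \<le> r j" using 4(1) by (intro L) (auto simp: N_def l_def)
      then have "drift b r (i, j) \<ge> 0" using sum_pos by (simp add: drift_def)
      moreover have "0 \<le> \<epsilon> * real l" using \<epsilon>(1) by simp
      ultimately have "- D * drift b r (i, j) \<ge> 0" using 4(2) by (intro mult_nonneg_nonneg) auto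
      then have "D * drift b r (i, j) \<le> 0" by simp
      then show ?thesis using C by (simp add: D_def)
    qed
  qed
  then show thesis using that[OF C] by blast
qed

text \<open>
  The drift contributes \<open>-(l + 1)\<^sup>\<alpha> \<alpha> D / l\<close>, the growth of the weight \<open>l\<^sup>\<alpha>\<close> contributes
  \<open>\<alpha> l\<^sup>\<alpha> D / l\<close>; their leading parts cancel, which is the reason for the scaling by \<open>l\<^sup>\<alpha>\<close>.
\<close>
lemma compensator_bound:
  assumes b: "power_weight \<alpha> b" and r: "power_weight \<alpha> r"
  obtains C where "C \<ge> 0"
    and "\<And>i j l x. l = i + j \<Longrightarrow> l \<ge> 1 \<Longrightarrow> x = (real j - real i) / real l \<Longrightarrow>
       \<bar>real (Suc l) powr \<alpha> * drift b r (i, j) + (real (Suc l) powr \<alpha> - real l powr \<alpha>) * (real j - real i)\<bar>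
       \<le> C * real l powr \<alpha> * (x\<^sup>2 + 1 / real l)"
proof -
  obtain A where A: "A \<ge> 0"
    "\<And>i j l x. l = i + j \<Longrightarrow> l \<ge> 1 \<Longrightarrow> x = (real j - real i) / real l \<Longrightarrow>
       \<bar>drift b r (i, j) + \<alpha> * x\<bar> \<le> A * (x\<^sup>2 + 1 / real l)"
    by (rule drift_linearization[OF b r]) blast
  obtain G where G: "G \<ge> 0"
    "\<And>y. - 1 / 2 \<le> y \<Longrightarrow> y \<le> 1 \<Longrightarrow> \<bar>(1 + y) powr \<alpha> - 1\<bar> \<le> G * \<bar>y\<bar>"
    by (rule powr_one_plus_linear[of \<alpha>]) blast
  obtain K where K: "K \<ge> 0"
    "\<And>y. - 1 / 2 \<le> y \<Longrightarrow> y \<le> 1 \<Longrightarrow> \<bar>(1 + y) powr \<alpha> - 1 - \<alpha> * y\<bar> \<le> K * y\<^sup>2"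
    by (rule powr_one_plus_quadratic[of \<alpha>]) blast
  define C where "C = G * \<bar>\<alpha>\<bar> + K + (1 + G) * A"
  have C: "C \<ge> 0" using A G K by (simp add: C_def)
  have "\<bar>real (Suc l) powr \<alpha> * drift b r (i, j) + (real (Suc l) powr \<alpha> - real l powr \<alpha>) * (real j - real i)\<bar>
       \<le> C * real l powr \<alpha> * (x\<^sup>2 + 1 / real l)"
    if l: "l = i + j" "l \<ge> 1" and x: "x = (real j - real i) / real l" for i j l x
  proof -
    define y where "y = 1 / real l"
    define g where "g = (1 + y) powr \<alpha> - 1"
    define e where "e = drift b r (i, j) + \<alpha> * x"
    have y: "0 < y" "y \<le> 1" "y * real l = 1" using l(2) by (auto simp: y_def)
    have x1: "\<bar>x\<bar> \<le> 1" using l by (auto simp: x abs_le_iff field_simps)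
    have g: "\<bar>g\<bar> \<le> G * y" using G(2)[of y] y by (simp add: g_def)
    have g1: "\<bar>g\<bar> \<le> G" using g y G(1) mult_left_mono[of y 1 G] by linarith
    have g2: "\<bar>(g - \<alpha> * y) * real l\<bar> \<le> K * y"
    proof -
      have "\<bar>g - \<alpha> * y\<bar> \<le> K * y\<^sup>2" using K(2)[of y] y by (simp add: g_def)
      then have "\<bar>g - \<alpha> * y\<bar> * real l \<le> K * y\<^sup>2 * real l" by (intro mult_right_mono) auto
      also have "\<dots> = K * y" using y(3) by (simp add: power2_eq_square mult.assoc)
      finally show ?thesis by (simp add: abs_mult)
    qed
    have e: "\<bar>e\<bar> \<le> A * (x\<^sup>2 + y)" using A(2)[OF l x] by (simp add: e_def y_def)
    have "real (Suc l) = real l * (1 + y)" using y(3) by (simp add: algebra_simps)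
    then have Suc_l: "real (Suc l) powr \<alpha> = real l powr \<alpha> * (1 + g)"
      using y by (simp add: powr_mult g_def)
    have D: "real j - real i = x * real l" using l(2) by (simp add: x)
    have "real (Suc l) powr \<alpha> * drift b r (i, j) + (real (Suc l) powr \<alpha> - real l powr \<alpha>) * (real j - real i)
        = real l powr \<alpha> * ((1 + g) * (e - \<alpha> * x) + g * (x * real l))"
      unfolding Suc_l D e_def by (simp add: algebra_simps)
    also have "(1 + g) * (e - \<alpha> * x) + g * (x * real l)
        = (1 + g) * e - g * (\<alpha> * x) + x * ((g - \<alpha> * y) * real l) + \<alpha> * x * (y * real l - 1)"
      by (simp add: algebra_simps)
    also have "\<dots> = (1 + g) * e - g * (\<alpha> * x) + x * ((g - \<alpha> * y) * real l)" using y(3) by simp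
    finally have eq: "real (Suc l) powr \<alpha> * drift b r (i, j) + (real (Suc l) powr \<alpha> - real l powr \<alpha>) * (real j - real i)
        = real l powr \<alpha> * ((1 + g) * e - g * (\<alpha> * x) + x * ((g - \<alpha> * y) * real l))" .
    have "\<bar>1 + g\<bar> * \<bar>e\<bar> \<le> (1 + G) * (A * (x\<^sup>2 + y))"
      using e g1 G(1) by (intro mult_mono) auto
    moreover have "\<bar>g\<bar> * (\<bar>\<alpha>\<bar> * \<bar>x\<bar>) \<le> (G * y) * (\<bar>\<alpha>\<bar> * 1)"
      using g x1 G(1) y by (intro mult_mono mult_left_mono) auto
    moreover have "\<bar>x\<bar> * \<bar>(g - \<alpha> * y) * real l\<bar> \<le> 1 * (K * y)"
      using g2 x1 by (intro mult_mono) auto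
    ultimately have "\<bar>(1 + g) * e - g * (\<alpha> * x) + x * ((g - \<alpha> * y) * real l)\<bar>
        \<le> (1 + G) * (A * (x\<^sup>2 + y)) + (G * y) * \<bar>\<alpha>\<bar> + K * y"
      unfolding abs_mult[symmetric] by linarith
    also have "\<dots> = C * (x\<^sup>2 + y) - (G * \<bar>\<alpha>\<bar> + K) * x\<^sup>2"
      by (simp add: C_def algebra_simps)
    also have "\<dots> \<le> C * (x\<^sup>2 + y)" using G K by simp
    finally have "real l powr \<alpha> * \<bar>(1 + g) * e - g * (\<alpha> * x) + x * ((g - \<alpha> * y) * real l)\<bar>
        \<le> real l powr \<alpha> * (C * (x\<^sup>2 + y))"
      by (intro mult_left_mono) auto
    then show ?thesis unfolding eq y_def by (simp add: abs_mult ac_simps)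
  qed
  then show thesis using that[OF C] by blast
qed

section \<open>Variance of a centred variable with a small perturbation\<close>

text \<open>
  The weighted inequality \<open>2 S R \<le> S\<^sup>2 / t + t R\<^sup>2\<close> takes the place of the Cauchy-Schwarz inequality; the
  optimal \<open>t\<close> is the ratio of the two root mean squares.
\<close>
lemma (in prob_space) variance_perturbation:
  fixes S R :: "'a \<Rightarrow> real"
  assumes int: "integrable M S" "integrable M R" "integrable M (\<lambda>\<omega>. (S \<omega>)\<^sup>2)"
      "integrable M (\<lambda>\<omega>. S \<omega> * R \<omega>)" "integrable M (\<lambda>\<omega>. (R \<omega>)\<^sup>2)"
    and mean: "expectation S = 0" and t: "t > 0"
  shows "\<bar>variance (\<lambda>\<omega>. S \<omega> + R \<omega>) - expectation (\<lambda>\<omega>. (S \<omega>)\<^sup>2)\<bar>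
    \<le> expectation (\<lambda>\<omega>. (S \<omega>)\<^sup>2) / t + (t + 1) * expectation (\<lambda>\<omega>. (R \<omega>)\<^sup>2)"
proof -
  have sq: "(S \<omega> + R \<omega>)\<^sup>2 = (S \<omega>)\<^sup>2 + 2 * (S \<omega> * R \<omega>) + (R \<omega>)\<^sup>2" for \<omega>
    by (simp add: power2_eq_square algebra_simps)
  have "variance (\<lambda>\<omega>. S \<omega> + R \<omega>) = expectation (\<lambda>\<omega>. (S \<omega> + R \<omega>)\<^sup>2) - (expectation (\<lambda>\<omega>. S \<omega> + R \<omega>))\<^sup>2"
    using int by (intro variance_eq) (simp_all add: sq)
  also have "\<dots> = expectation (\<lambda>\<omega>. (S \<omega>)\<^sup>2) + 2 * expectation (\<lambda>\<omega>. S \<omega> * R \<omega>)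
      + (expectation (\<lambda>\<omega>. (R \<omega>)\<^sup>2) - (expectation R)\<^sup>2)"
    using int mean by (simp add: sq)
  also have "expectation (\<lambda>\<omega>. (R \<omega>)\<^sup>2) - (expectation R)\<^sup>2 = variance R"
    using int by (simp add: variance_eq)
  finally have var: "variance (\<lambda>\<omega>. S \<omega> + R \<omega>) = expectation (\<lambda>\<omega>. (S \<omega>)\<^sup>2) + 2 * expectation (\<lambda>\<omega>. S \<omega> * R \<omega>) + variance R" .
  have "variance R \<ge> 0" by (rule variance_positive)
  moreover have "variance R \<le> expectation (\<lambda>\<omega>. (R \<omega>)\<^sup>2)"
    using int by (simp add: variance_eq)
  moreover have "\<bar>2 * expectation (\<lambda>\<omega>. S \<omega> * R \<omega>)\<bar> \<le> expectation (\<lambda>\<omega>. (S \<omega>)\<^sup>2) / t + t * expectation (\<lambda>\<omega>. (R \<omega>)\<^sup>2)"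
  proof -
    have young: "\<bar>2 * (S \<omega> * R \<omega>)\<bar> \<le> (S \<omega>)\<^sup>2 / t + t * (R \<omega>)\<^sup>2" for \<omega>
    proof -
      have "0 \<le> (\<bar>S \<omega>\<bar> - t * \<bar>R \<omega>\<bar>)\<^sup>2" by simp
      then have "2 * t * \<bar>S \<omega> * R \<omega>\<bar> \<le> (S \<omega>)\<^sup>2 + t\<^sup>2 * (R \<omega>)\<^sup>2"
        by (simp add: power2_diff power_mult_distrib abs_mult algebra_simps)
      then show ?thesis using t by (simp add: field_simps power2_eq_square abs_mult)
    qed
    have "\<bar>2 * expectation (\<lambda>\<omega>. S \<omega> * R \<omega>)\<bar> = \<bar>expectation (\<lambda>\<omega>. 2 * (S \<omega> * R \<omega>))\<bar>" using int by simp
    also have "\<dots> \<le> expectation (\<lambda>\<omega>. \<bar>2 * (S \<omega> * R \<omega>)\<bar>)" by (rule integral_abs_bound)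
    also have "\<dots> \<le> expectation (\<lambda>\<omega>. (S \<omega>)\<^sup>2 / t + t * (R \<omega>)\<^sup>2)"
      using int young by (intro integral_mono) auto
    also have "\<dots> = expectation (\<lambda>\<omega>. (S \<omega>)\<^sup>2) / t + t * expectation (\<lambda>\<omega>. (R \<omega>)\<^sup>2)" using int by simp
    finally show ?thesis .
  qed
  ultimately show ?thesis unfolding var distrib_right by linarith
qed

section \<open>Conditioning on the history of the urn\<close>

locale positive_urn = prob_space M
  for M :: "'a measure" and b r :: "nat \<Rightarrow> real" and X :: "nat \<Rightarrow> 'a \<Rightarrow> nat \<times> nat" +
  assumes urn: "polya_urn M b r X"
    and b_pos: "\<And>i. b i > 0" and r_pos: "\<And>j. r j > 0"
begin

abbreviation D :: "nat \<Rightarrow> 'a \<Rightarrow> real" where "D \<equiv> discrepancy X"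

abbreviation d :: "nat \<Rightarrow> 'a \<Rightarrow> real" where "d n \<omega> \<equiv> drift b r (X n \<omega>)"

definition history :: "nat \<Rightarrow> 'a \<Rightarrow> (nat \<times> nat) list" where
  "history n \<omega> = map (\<lambda>l. X l \<omega>) [0..<Suc n]"

lemma X_measurable [measurable]: "X n \<in> measurable M (count_space UNIV)"
  using urn by (simp add: polya_urn_def)

lemma history_eq_iff:
  "history n \<omega> = h \<longleftrightarrow> length h = Suc n \<and> (\<forall>l\<le>n. X l \<omega> = h ! l)"
  by (auto simp: history_def list_eq_iff_nth_eq less_Suc_eq_le simp del: upt_Suc)

lemma last_history: "last (history n \<omega>) = X n \<omega>"
  by (simp add: history_def)

lemma history_measurable [measurable]: "history n \<in> measurable M (count_space UNIV)"
proof (subst measurable_count_space_eq2_countable, safe)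
  fix h :: "(nat \<times> nat) list"
  have "history n -` {h} \<inter> space M = {\<omega> \<in> space M. length h = Suc n \<and> (\<forall>l\<le>n. X l \<omega> = h ! l)}"
    unfolding vimage_def Int_def using history_eq_iff[of n _ h] by blast
  also have "\<dots> \<in> sets M" by measurable
  finally show "history n -` {h} \<inter> space M \<in> sets M" .
qed auto

lemma D_measurable [measurable]: "D n \<in> borel_measurable M"
proof -
  have "(\<lambda>s. real (snd s) - real (fst s)) \<circ> X n \<in> borel_measurable M"
    by (rule measurable_comp[OF X_measurable]) simp
  then show ?thesis by (simp add: discrepancy_def[abs_def] comp_def)
qed

text \<open>
  Multiplying the transition probability by the probability of the history makes the law of a single
  step meaningful also for histories of probability 0.
\<close>
lemma step_probability:
  shows "prob {\<omega> \<in> space M. history n \<omega> = h \<and> X (Suc n) \<omega> = (Suc (fst (last h)), snd (last h))}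
      = b (fst (last h)) / (b (fst (last h)) + r (snd (last h))) * prob {\<omega> \<in> space M. history n \<omega> = h}"
    (is "prob ?B = ?p * prob ?H")
  and "prob {\<omega> \<in> space M. history n \<omega> = h \<and> X (Suc n) \<omega> = (fst (last h), Suc (snd (last h)))}
      = r (snd (last h)) / (b (fst (last h)) + r (snd (last h))) * prob {\<omega> \<in> space M. history n \<omega> = h}"
    (is "prob ?R = ?q * prob ?H")
proof -
  have sub: "prob ?B \<le> prob ?H" "prob ?R \<le> prob ?H"
    by (auto intro!: finite_measure_mono)
  have "prob ?B = ?p * prob ?H \<and> prob ?R = ?q * prob ?H"
  proof (cases "prob ?H = 0")
    case True
    then show ?thesis using sub measure_nonneg[of M ?B] measure_nonneg[of M ?R] by simp
  next
    case False
    then have pos: "prob ?H > 0" by (simp add: zero_less_measure_iff)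
    have len: "length h = Suc n"
    proof (rule ccontr)
      assume "length h \<noteq> Suc n"
      then have "?H = {}" using history_eq_iff[of n _ h] by blast
      then have "prob ?H = prob {}" by (rule arg_cong)
      then show False using False by simp
    qed
    then have last: "last h = h ! n" by (cases h) (auto simp: last_conv_nth)
    have eq: "(\<forall>l\<le>n. X l \<omega> = h ! l) \<longleftrightarrow> history n \<omega> = h" for \<omega>
      using len by (auto simp: history_eq_iff)
    have "\<P>(\<omega> in M. X (Suc n) \<omega> = (Suc (fst (last h)), snd (last h)) \<bar> \<forall>l\<le>n. X l \<omega> = h ! l) = ?p \<and>
        \<P>(\<omega> in M. X (Suc n) \<omega> = (fst (last h), Suc (snd (last h))) \<bar> \<forall>l\<le>n. X l \<omega> = h ! l) = ?q"
    proof (rule urn[unfolded polya_urn_def, THEN conjunct2, THEN conjunct2, THEN conjunct2, rule_format])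
      show "h ! n = (fst (last h), snd (last h))" by (simp add: last)
      show "\<P>(\<omega> in M. \<forall>l\<le>n. X l \<omega> = h ! l) > 0" using pos by (simp only: eq)
    qed
    then show ?thesis using pos unfolding eq cond_prob_def
      by (simp add: field_simps conj_commute)
  qed
  then show "prob ?B = ?p * prob ?H" "prob ?R = ?q * prob ?H" by auto
qed

lemma AE_step: "AE \<omega> in M. X (Suc n) \<omega> = (Suc (fst (X n \<omega>)), snd (X n \<omega>)) \<or>
    X (Suc n) \<omega> = (fst (X n \<omega>), Suc (snd (X n \<omega>)))"
proof -
  have "AE \<omega> in M. history n \<omega> = h \<longrightarrow> X (Suc n) \<omega> = (Suc (fst (last h)), snd (last h)) \<or>
      X (Suc n) \<omega> = (fst (last h), Suc (snd (last h)))" for h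
  proof -
    define H where "H = {\<omega> \<in> space M. history n \<omega> = h}"
    define A where "A = {\<omega> \<in> space M. history n \<omega> = h \<and> X (Suc n) \<omega> = (Suc (fst (last h)), snd (last h))}"
    define C where "C = {\<omega> \<in> space M. history n \<omega> = h \<and> X (Suc n) \<omega> = (fst (last h), Suc (snd (last h)))}"
    have sets: "H \<in> sets M" "A \<in> sets M" "C \<in> sets M" unfolding H_def A_def C_def by measurable
    have "prob (A \<union> C) = prob A + prob C"
      using sets by (intro finite_measure_Union) (auto simp: A_def C_def)
    also have "\<dots> = (b (fst (last h)) / (b (fst (last h)) + r (snd (last h)))
        + r (snd (last h)) / (b (fst (last h)) + r (snd (last h)))) * prob H"
      unfolding A_def C_def H_def step_probability by (simp only: distrib_right)
    also have "\<dots> = prob H"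
      using b_pos[of "fst (last h)"] r_pos[of "snd (last h)"] by (simp add: add_divide_distrib[symmetric])
    finally have "prob (H - (A \<union> C)) = 0"
      using sets by (subst finite_measure_Diff) (auto simp: A_def C_def H_def)
    then have "AE \<omega> in M. \<omega> \<notin> H - (A \<union> C)"
      using sets by (subst (asm) prob_eq_0) auto
    then show ?thesis
      by (rule AE_mp[OF _ AE_I2]) (auto simp: A_def C_def H_def)
  qed
  then have "AE \<omega> in M. \<forall>h. history n \<omega> = h \<longrightarrow> X (Suc n) \<omega> = (Suc (fst (last h)), snd (last h)) \<or>
      X (Suc n) \<omega> = (fst (last h), Suc (snd (last h)))"
    by (subst AE_all_countable) blast
  then show ?thesis by (rule AE_mp[OF _ AE_I2]) (simp add: last_history)
qed

lemma AE_total: "AE \<omega> in M. \<forall>n. fst (X n \<omega>) + snd (X n \<omega>) = n"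
proof (subst AE_all_countable, intro allI)
  fix n
  show "AE \<omega> in M. fst (X n \<omega>) + snd (X n \<omega>) = n"
  proof (induction n)
    case 0
    have "AE \<omega> in M. X 0 \<omega> = (0, 0)" using urn by (simp add: polya_urn_def)
    then show ?case by eventually_elim simp
  next
    case (Suc n)
    show ?case using Suc AE_step[of n] by eventually_elim auto
  qed
qed

lemma AE_abs_D_le: "AE \<omega> in M. \<bar>D n \<omega>\<bar> \<le> real n"
  using AE_total
proof eventually_elim
  case (elim \<omega>)
  then have "fst (X n \<omega>) + snd (X n \<omega>) = n" by blast
  then have "real n = real (fst (X n \<omega>)) + real (snd (X n \<omega>))" by (metis of_nat_add)
  then show ?case by (simp add: discrepancy_def)
qed

lemma AE_increment_sq: "AE \<omega> in M. (D (Suc n) \<omega> - D n \<omega>)\<^sup>2 = 1"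
  using AE_step[of n]
proof eventually_elim
  case (elim \<omega>)
  then show ?case by (elim disjE) (simp_all add: discrepancy_def)
qed

definition histories :: "nat \<Rightarrow> (nat \<times> nat) list set" where
  "histories n = {h. set h \<subseteq> {..n} \<times> {..n} \<and> length h = Suc n}"

lemma finite_histories: "finite (histories n)"
  unfolding histories_def by (rule finite_lists_length_eq) simp

lemma AE_history: "AE \<omega> in M. history n \<omega> \<in> histories n"
  using AE_total
proof eventually_elim
  case (elim \<omega>)
  have "X l \<omega> \<in> {..n} \<times> {..n}" if "l \<le> n" for l
    using elim[rule_format, of l] that by (cases "X l \<omega>") auto
  then have "set (history n \<omega>) \<subseteq> {..n} \<times> {..n}"
    unfolding history_def set_map by (intro image_subsetI) (simp del: upt_Suc)
  then show ?case by (simp add: histories_def history_def del: upt_Suc)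
qed

text \<open>
  This is measurability with respect to the states up to time \<open>n\<close>. In this pointwise form its closure
  properties are congruence rules, and \<open>determined_history\<close> supplies the factorisation through the history.
\<close>
definition determined :: "nat \<Rightarrow> ('a \<Rightarrow> real) \<Rightarrow> bool" where
  "determined n Y \<longleftrightarrow> (\<forall>\<omega> \<omega>'. (\<forall>l\<le>n. X l \<omega> = X l \<omega>') \<longrightarrow> Y \<omega> = Y \<omega>')"

lemma determined_history:
  assumes "determined n Y"
  obtains \<phi> where "\<And>\<omega>. Y \<omega> = \<phi> (history n \<omega>)"
proof
  fix \<omega>
  define \<omega>' where "\<omega>' = inv (history n) (history n \<omega>)"
  have "history n \<omega>' = history n \<omega>" unfolding \<omega>'_def by (rule f_inv_into_f) simp
  then have "\<forall>l\<le>n. X l \<omega> = X l \<omega>'" by (simp add: history_eq_iff history_def del: upt_Suc)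
  then show "Y \<omega> = (\<lambda>h. Y (inv (history n) h)) (history n \<omega>)"
    using assms unfolding determined_def \<omega>'_def by blast
qed

lemma determined_D: "l \<le> n \<Longrightarrow> determined n (D l)"
  by (auto simp: determined_def discrepancy_def)

lemma determined_d: "l \<le> n \<Longrightarrow> determined n (d l)"
  by (auto simp: determined_def)

lemma determined_const: "determined n (\<lambda>\<omega>. c)"
  by (simp add: determined_def)

lemma determined_add: "determined n Y \<Longrightarrow> determined n Z \<Longrightarrow> determined n (\<lambda>\<omega>. Y \<omega> + Z \<omega>)"
  unfolding determined_def by (intro allI impI arg_cong2[where f="(+)"]) blast+

lemma determined_diff: "determined n Y \<Longrightarrow> determined n Z \<Longrightarrow> determined n (\<lambda>\<omega>. Y \<omega> - Z \<omega>)"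
  unfolding determined_def by (intro allI impI arg_cong2[where f="(-)"]) blast+

lemma determined_mult: "determined n Y \<Longrightarrow> determined n Z \<Longrightarrow> determined n (\<lambda>\<omega>. Y \<omega> * Z \<omega>)"
  unfolding determined_def by (intro allI impI arg_cong2[where f="(*)"]) blast+

lemma determined_power: "determined n Y \<Longrightarrow> determined n (\<lambda>\<omega>. Y \<omega> ^ p)"
  unfolding determined_def by (intro allI impI arg_cong[where f="\<lambda>y. y ^ p"]) blast

lemma determined_sum: "(\<And>l. l \<in> A \<Longrightarrow> determined n (Y l)) \<Longrightarrow> determined n (\<lambda>\<omega>. \<Sum>l\<in>A. Y l \<omega>)"
  unfolding determined_def by (intro allI impI sum.cong refl) blast

lemmas determined_intros = determined_D determined_d determined_const determined_add
  determined_diff determined_mult determined_power determined_sum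

text \<open>Almost surely there are only finitely many histories, so such a variable is essentially bounded.\<close>
lemma determined_integrable:
  assumes "determined n Y"
  shows "integrable M Y"
proof -
  obtain \<phi> where \<phi>: "\<And>\<omega>. Y \<omega> = \<phi> (history n \<omega>)" by (rule determined_history[OF assms]) blast
  have "(\<lambda>\<omega>. \<phi> (history n \<omega>)) \<in> borel_measurable M"
    using measurable_comp[OF history_measurable, of \<phi> borel] by (simp add: comp_def)
  then have "integrable M (\<lambda>\<omega>. \<phi> (history n \<omega>))"
  proof (rule integrable_const_bound[rotated])
    show "AE \<omega> in M. norm (\<phi> (history n \<omega>)) \<le> (\<Sum>h\<in>histories n. \<bar>\<phi> h\<bar>)"
      using AE_history by eventually_elim
        (auto intro!: member_le_sum[of _ _ "\<lambda>h. \<bar>\<phi> h\<bar>"] finite_histories)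
  qed
  then show ?thesis using \<phi> by presburger
qed

text \<open>
  The Markov property in the only form that is needed later: given the past, the increment of the
  discrepancy has mean \<open>d n\<close>. The proof decomposes both sides over the finitely many histories.
\<close>
lemma expectation_increment:
  assumes "determined n Y"
  shows "expectation (\<lambda>\<omega>. Y \<omega> * (D (Suc n) \<omega> - D n \<omega>)) = expectation (\<lambda>\<omega>. Y \<omega> * d n \<omega>)"
proof -
  obtain \<phi> where \<phi>: "\<And>\<omega>. Y \<omega> = \<phi> (history n \<omega>)" by (rule determined_history[OF assms]) blast
  define H where "H h = {\<omega> \<in> space M. history n \<omega> = h}" for h
  define A where "A h = {\<omega> \<in> space M. history n \<omega> = h \<and> X (Suc n) \<omega> = (Suc (fst (last h)), snd (last h))}" for h
  define C where "C h = {\<omega> \<in> space M. history n \<omega> = h \<and> X (Suc n) \<omega> = (fst (last h), Suc (snd (last h)))}" for h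
  have [measurable]: "H h \<in> sets M" "A h \<in> sets M" "C h \<in> sets M" for h
    unfolding H_def A_def C_def by measurable
  have "expectation (\<lambda>\<omega>. Y \<omega> * (D (Suc n) \<omega> - D n \<omega>))
      = expectation (\<lambda>\<omega>. \<Sum>h\<in>histories n. \<phi> h * (indicator (C h) \<omega> - indicator (A h) \<omega>))"
  proof (rule integral_cong_AE)
    show "(\<lambda>\<omega>. Y \<omega> * (D (Suc n) \<omega> - D n \<omega>)) \<in> borel_measurable M"
      using determined_integrable[OF assms] by measurable
    show "AE \<omega> in M. Y \<omega> * (D (Suc n) \<omega> - D n \<omega>)
        = (\<Sum>h\<in>histories n. \<phi> h * (indicator (C h) \<omega> - indicator (A h) \<omega>))"
      using AE_history[of n] AE_step[of n] AE_space
    proof eventually_elim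
      case (elim \<omega>)
      have "(\<Sum>h\<in>histories n. \<phi> h * (indicator (C h) \<omega> - indicator (A h) \<omega>))
          = (\<Sum>h\<in>histories n. if h = history n \<omega> then \<phi> h * (D (Suc n) \<omega> - D n \<omega>) else 0)"
      proof (rule sum.cong[OF refl])
        fix h
        show "\<phi> h * (indicator (C h) \<omega> - indicator (A h) \<omega>)
            = (if h = history n \<omega> then \<phi> h * (D (Suc n) \<omega> - D n \<omega>) else 0)"
        proof (cases "h = history n \<omega>")
          case True
          then have "last h = X n \<omega>" by (simp add: last_history)
          with elim(2) show ?thesis
            using True elim(3) by (elim disjE) (simp_all add: A_def C_def discrepancy_def)
        next
          case False
          then show ?thesis by (simp add: A_def C_def)
        qed
      qed
      then show ?case using elim(1) finite_histories by (simp add: \<phi>)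
    qed
  qed measurable
  also have "\<dots> = (\<Sum>h\<in>histories n. \<phi> h * (prob (C h) - prob (A h)))"
    by (simp add: Bochner_Integration.integral_sum emeasure_eq_measure)
  also have "\<dots> = (\<Sum>h\<in>histories n. \<phi> h * (drift b r (last h) * prob (H h)))"
    unfolding A_def C_def H_def step_probability drift_def by (simp add: diff_divide_distrib algebra_simps)
  also have "\<dots> = expectation (\<lambda>\<omega>. \<Sum>h\<in>histories n. \<phi> h * (drift b r (last h) * indicator (H h) \<omega>))"
    by (simp add: Bochner_Integration.integral_sum emeasure_eq_measure)
  also have "\<dots> = expectation (\<lambda>\<omega>. Y \<omega> * d n \<omega>)"
  proof (rule integral_cong_AE)
    show "(\<lambda>\<omega>. Y \<omega> * d n \<omega>) \<in> borel_measurable M"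
      using determined_integrable[OF determined_mult[OF assms determined_d[OF order_refl]]] by measurable
    show "AE \<omega> in M. (\<Sum>h\<in>histories n. \<phi> h * (drift b r (last h) * indicator (H h) \<omega>)) = Y \<omega> * d n \<omega>"
      using AE_history[of n] AE_space
    proof eventually_elim
      case (elim \<omega>)
      have "(\<Sum>h\<in>histories n. \<phi> h * (drift b r (last h) * indicator (H h) \<omega>))
          = (\<Sum>h\<in>histories n. if h = history n \<omega> then \<phi> h * d n \<omega> else 0)"
        using elim(2) by (intro sum.cong) (auto simp: H_def last_history)
      then show ?case using elim(1) finite_histories by (simp add: \<phi>)
    qed
  qed measurable
  finally show ?thesis .
qed

section \<open>Moments of the discrepancy\<close>

lemma D_eq: "D n \<omega> = real (snd (X n \<omega>)) - real (fst (X n \<omega>))"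
  by (simp add: discrepancy_def)

lemma AE_D_0: "AE \<omega> in M. D 0 \<omega> = 0"
  using AE_abs_D_le[of 0] by eventually_elim simp

text \<open>
  As \<open>\<Delta>\<^sup>2 = 1\<close>, one step adds \<open>2 E[D d] + 1\<close> to the second moment.
\<close>
lemma second_moment_bound:
  assumes C: "C \<ge> 0" "\<And>i j. (real j - real i) * drift b r (i, j) \<le> C"
  shows "expectation (\<lambda>\<omega>. (D n \<omega>)\<^sup>2) \<le> (2 * C + 1) * real n"
proof (induction n)
  case 0
  have "expectation (\<lambda>\<omega>. (D 0 \<omega>)\<^sup>2) = expectation (\<lambda>\<omega>. 0)"
    using AE_D_0 by (intro integral_cong_AE) auto
  then show ?case by simp
next
  case (Suc n)
  have int: "integrable M (\<lambda>\<omega>. (D n \<omega>)\<^sup>2)" "integrable M (\<lambda>\<omega>. D n \<omega> * d n \<omega>)"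
    "integrable M (\<lambda>\<omega>. D n \<omega> * (D (Suc n) \<omega> - D n \<omega>))"
    by (intro determined_integrable[of "Suc n"] determined_intros; simp)+
  have "expectation (\<lambda>\<omega>. (D (Suc n) \<omega>)\<^sup>2)
      = expectation (\<lambda>\<omega>. (D n \<omega>)\<^sup>2 + 2 * (D n \<omega> * (D (Suc n) \<omega> - D n \<omega>)) + 1)"
  proof (rule integral_cong_AE)
    show "AE \<omega> in M. (D (Suc n) \<omega>)\<^sup>2 = (D n \<omega>)\<^sup>2 + 2 * (D n \<omega> * (D (Suc n) \<omega> - D n \<omega>)) + 1"
      using AE_increment_sq[of n] by eventually_elim (simp add: power2_eq_square algebra_simps)
  qed measurable
  also have "\<dots> = expectation (\<lambda>\<omega>. (D n \<omega>)\<^sup>2) + 2 * expectation (\<lambda>\<omega>. D n \<omega> * (D (Suc n) \<omega> - D n \<omega>)) + 1"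
    using int by (simp add: prob_space)
  also have "\<dots> = expectation (\<lambda>\<omega>. (D n \<omega>)\<^sup>2) + 2 * expectation (\<lambda>\<omega>. D n \<omega> * d n \<omega>) + 1"
    by (simp only: expectation_increment[OF determined_D[OF order_refl]])
  also have "expectation (\<lambda>\<omega>. D n \<omega> * d n \<omega>) \<le> expectation (\<lambda>\<omega>. C)"
  proof (rule integral_mono)
    show "D n \<omega> * d n \<omega> \<le> C" for \<omega>
      using C(2)[of "snd (X n \<omega>)" "fst (X n \<omega>)"] by (simp add: D_eq)
  qed (use int in auto)
  finally show ?case using Suc by (simp add: prob_space algebra_simps)
qed

text \<open>
  One step adds \<open>4 E[D\<^sup>3 d] + 6 E[D\<^sup>2] + 4 E[D d] + 1\<close>, and \<open>D\<^sup>3 d = D\<^sup>2 (D d) \<le> C D\<^sup>2\<close> reduces this to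
  the second moment.
\<close>
lemma fourth_moment_bound:
  assumes C: "C \<ge> 0" "\<And>i j. (real j - real i) * drift b r (i, j) \<le> C"
  shows "expectation (\<lambda>\<omega>. D n \<omega> ^ 4) \<le> ((4 * C + 6) * (2 * C + 1) + 4 * C + 1) * (real n)\<^sup>2"
proof (induction n)
  case 0
  have "expectation (\<lambda>\<omega>. D 0 \<omega> ^ 4) = expectation (\<lambda>\<omega>. 0)"
    using AE_D_0 by (intro integral_cong_AE) auto
  then show ?case by simp
next
  case (Suc n)
  define K where "K = (4 * C + 6) * (2 * C + 1)"
  have K: "K \<ge> 0" using C(1) by (simp add: K_def)
  have int: "integrable M (\<lambda>\<omega>. (D n \<omega>)\<^sup>2)" "integrable M (\<lambda>\<omega>. D n \<omega> ^ 4)"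
    "integrable M (\<lambda>\<omega>. D n \<omega> * d n \<omega>)" "integrable M (\<lambda>\<omega>. D n \<omega> ^ 3 * d n \<omega>)"
    "integrable M (\<lambda>\<omega>. D n \<omega> * (D (Suc n) \<omega> - D n \<omega>))"
    "integrable M (\<lambda>\<omega>. D n \<omega> ^ 3 * (D (Suc n) \<omega> - D n \<omega>))"
    by (intro determined_integrable[of "Suc n"] determined_intros; simp)+
  have dc: "D n \<omega> * d n \<omega> \<le> C" for \<omega>
    using C(2)[of "snd (X n \<omega>)" "fst (X n \<omega>)"] by (simp add: D_eq)
  have "expectation (\<lambda>\<omega>. D (Suc n) \<omega> ^ 4)
      = expectation (\<lambda>\<omega>. D n \<omega> ^ 4 + 4 * (D n \<omega> ^ 3 * (D (Suc n) \<omega> - D n \<omega>)) + 6 * (D n \<omega>)\<^sup>2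
          + 4 * (D n \<omega> * (D (Suc n) \<omega> - D n \<omega>)) + 1)"
  proof (rule integral_cong_AE)
    have expand: "y ^ 4 = x ^ 4 + 4 * (x ^ 3 * (y - x)) + 6 * x\<^sup>2 + 4 * (x * (y - x)) + 1"
      if "(y - x)\<^sup>2 = 1" for x y :: real
    proof -
      have "y ^ 4 = x ^ 4 + 4 * (x ^ 3 * (y - x)) + 6 * x\<^sup>2 * (y - x)\<^sup>2
          + 4 * (x * (y - x)) * (y - x)\<^sup>2 + ((y - x)\<^sup>2)\<^sup>2"
        by (simp add: power2_eq_square power3_eq_cube power4_eq_xxxx algebra_simps)
      then show ?thesis unfolding that by simp
    qed
    show "AE \<omega> in M. D (Suc n) \<omega> ^ 4 = D n \<omega> ^ 4 + 4 * (D n \<omega> ^ 3 * (D (Suc n) \<omega> - D n \<omega>)) + 6 * (D n \<omega>)\<^sup>2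
          + 4 * (D n \<omega> * (D (Suc n) \<omega> - D n \<omega>)) + 1"
      using AE_increment_sq[of n] by eventually_elim (rule expand)
  qed measurable
  also have "\<dots> = expectation (\<lambda>\<omega>. D n \<omega> ^ 4) + 4 * expectation (\<lambda>\<omega>. D n \<omega> ^ 3 * (D (Suc n) \<omega> - D n \<omega>))
      + 6 * expectation (\<lambda>\<omega>. (D n \<omega>)\<^sup>2) + 4 * expectation (\<lambda>\<omega>. D n \<omega> * (D (Suc n) \<omega> - D n \<omega>)) + 1"
    using int by (simp add: prob_space)
  also have "\<dots> = expectation (\<lambda>\<omega>. D n \<omega> ^ 4) + 4 * expectation (\<lambda>\<omega>. D n \<omega> ^ 3 * d n \<omega>)
      + 6 * expectation (\<lambda>\<omega>. (D n \<omega>)\<^sup>2) + 4 * expectation (\<lambda>\<omega>. D n \<omega> * d n \<omega>) + 1"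
    by (simp only: expectation_increment[OF determined_D[OF order_refl]]
        expectation_increment[OF determined_power[OF determined_D[OF order_refl]]])
  finally have rec: "expectation (\<lambda>\<omega>. D (Suc n) \<omega> ^ 4) = expectation (\<lambda>\<omega>. D n \<omega> ^ 4)
      + 4 * expectation (\<lambda>\<omega>. D n \<omega> ^ 3 * d n \<omega>)
      + 6 * expectation (\<lambda>\<omega>. (D n \<omega>)\<^sup>2) + 4 * expectation (\<lambda>\<omega>. D n \<omega> * d n \<omega>) + 1" .
  have "expectation (\<lambda>\<omega>. D n \<omega> * d n \<omega>) \<le> expectation (\<lambda>\<omega>. C)"
    using int dc by (intro integral_mono) auto
  then have 1: "expectation (\<lambda>\<omega>. D n \<omega> * d n \<omega>) \<le> C" by (simp add: prob_space)
  have "expectation (\<lambda>\<omega>. D n \<omega> ^ 3 * d n \<omega>) \<le> expectation (\<lambda>\<omega>. (D n \<omega>)\<^sup>2 * C)"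
  proof (rule integral_mono)
    fix \<omega>
    have "D n \<omega> ^ 3 * d n \<omega> = (D n \<omega>)\<^sup>2 * (D n \<omega> * d n \<omega>)"
      by (simp add: power2_eq_square power3_eq_cube)
    also have "\<dots> \<le> (D n \<omega>)\<^sup>2 * C" using dc by (intro mult_left_mono) auto
    finally show "D n \<omega> ^ 3 * d n \<omega> \<le> (D n \<omega>)\<^sup>2 * C" .
  qed (use int in auto)
  then have "expectation (\<lambda>\<omega>. D n \<omega> ^ 3 * d n \<omega>) \<le> C * expectation (\<lambda>\<omega>. (D n \<omega>)\<^sup>2)"
    by (simp add: mult.commute)
  then have "4 * expectation (\<lambda>\<omega>. D n \<omega> ^ 3 * d n \<omega>) + 6 * expectation (\<lambda>\<omega>. (D n \<omega>)\<^sup>2)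
      \<le> (4 * C + 6) * expectation (\<lambda>\<omega>. (D n \<omega>)\<^sup>2)" by (simp add: algebra_simps)
  also have "\<dots> \<le> (4 * C + 6) * ((2 * C + 1) * real n)"
    using C(1) by (intro mult_left_mono second_moment_bound[OF C]) auto
  finally have "expectation (\<lambda>\<omega>. D (Suc n) \<omega> ^ 4) \<le> (K + 4 * C + 1) * (real n)\<^sup>2 + K * real n + 4 * C + 1"
    using rec 1 Suc by (simp add: K_def)
  also have "\<dots> \<le> (K + 4 * C + 1) * (real (Suc n))\<^sup>2"
  proof -
    have "(K + 4 * C + 1) * (real (Suc n))\<^sup>2
        = ((K + 4 * C + 1) * (real n)\<^sup>2 + K * real n + 4 * C + 1) + (K + (K + 8 * C + 2) * real n)"
      by (simp add: power2_eq_square algebra_simps)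
    moreover have "0 \<le> K + (K + 8 * C + 2) * real n" using K C(1) by simp
    ultimately show ?thesis by linarith
  qed
  finally show ?case by (simp add: K_def)
qed

definition noise :: "nat \<Rightarrow> 'a \<Rightarrow> real" where
  "noise n \<omega> = D (Suc n) \<omega> - D n \<omega> - d n \<omega>"

lemma determined_noise: "n < m \<Longrightarrow> determined m (noise n)"
  unfolding noise_def[abs_def] by (intro determined_intros) auto

lemma noise_orthogonal:
  assumes "determined n Y"
  shows "expectation (\<lambda>\<omega>. Y \<omega> * noise n \<omega>) = 0"
proof -
  have Y: "determined (Suc n) Y" using assms unfolding determined_def by (meson le_Suc_eq)
  have "integrable M (\<lambda>\<omega>. Y \<omega> * (D (Suc n) \<omega> - D n \<omega>))" "integrable M (\<lambda>\<omega>. Y \<omega> * d n \<omega>)"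
    by (intro determined_integrable[of "Suc n"] determined_intros Y; simp)+
  then have "expectation (\<lambda>\<omega>. Y \<omega> * noise n \<omega>)
      = expectation (\<lambda>\<omega>. Y \<omega> * (D (Suc n) \<omega> - D n \<omega>)) - expectation (\<lambda>\<omega>. Y \<omega> * d n \<omega>)"
    unfolding noise_def right_diff_distrib[of "Y _" "_ - _"] by (rule Bochner_Integration.integral_diff)
  then show ?thesis using expectation_increment[OF assms] by simp
qed

lemma noise_second_moment: "expectation (\<lambda>\<omega>. (noise n \<omega>)\<^sup>2) = 1 - expectation (\<lambda>\<omega>. (d n \<omega>)\<^sup>2)"
proof -
  have int: "integrable M (\<lambda>\<omega>. d n \<omega> * (D (Suc n) \<omega> - D n \<omega>))" "integrable M (\<lambda>\<omega>. (d n \<omega>)\<^sup>2)"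
    by (intro determined_integrable[of "Suc n"] determined_intros; simp)+
  have [measurable]: "noise n \<in> borel_measurable M" "d n \<in> borel_measurable M"
    using determined_integrable[OF determined_noise[of n "Suc n"]]
      determined_integrable[OF determined_d[of n n]] by auto
  have "expectation (\<lambda>\<omega>. (noise n \<omega>)\<^sup>2)
      = expectation (\<lambda>\<omega>. 1 - 2 * (d n \<omega> * (D (Suc n) \<omega> - D n \<omega>)) + (d n \<omega>)\<^sup>2)"
  proof (rule integral_cong_AE)
    show "AE \<omega> in M. (noise n \<omega>)\<^sup>2 = 1 - 2 * (d n \<omega> * (D (Suc n) \<omega> - D n \<omega>)) + (d n \<omega>)\<^sup>2"
      using AE_increment_sq[of n]
      by eventually_elim (simp add: noise_def power2_eq_square algebra_simps)
  qed measurable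
  also have "\<dots> = 1 - 2 * expectation (\<lambda>\<omega>. d n \<omega> * (D (Suc n) \<omega> - D n \<omega>)) + expectation (\<lambda>\<omega>. (d n \<omega>)\<^sup>2)"
    using int by (simp add: prob_space)
  also have "expectation (\<lambda>\<omega>. d n \<omega> * (D (Suc n) \<omega> - D n \<omega>)) = expectation (\<lambda>\<omega>. (d n \<omega>)\<^sup>2)"
    unfolding power2_eq_square by (rule expectation_increment) (rule determined_d, simp)
  finally show ?thesis by simp
qed

lemma martingale_second_moment:
  assumes "k \<le> m"
  shows "expectation (\<lambda>\<omega>. (\<Sum>l=k..<m. c l * noise l \<omega>)\<^sup>2)
     = (\<Sum>l=k..<m. (c l)\<^sup>2 * (1 - expectation (\<lambda>\<omega>. (d l \<omega>)\<^sup>2)))"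
  using assms
proof (induction m rule: dec_induct)
  case (step m)
  define S where "S \<omega> = (\<Sum>l=k..<m. c l * noise l \<omega>)" for \<omega>
  have S: "determined m S" unfolding S_def[abs_def]
    by (intro determined_intros determined_noise) auto
  have S': "determined (Suc m) S" unfolding S_def[abs_def]
    by (intro determined_intros determined_noise) auto
  have int: "integrable M (\<lambda>\<omega>. (S \<omega>)\<^sup>2)" "integrable M (\<lambda>\<omega>. S \<omega> * noise m \<omega>)" "integrable M (\<lambda>\<omega>. (noise m \<omega>)\<^sup>2)"
    by (intro determined_integrable[of "Suc m"] determined_intros S' determined_noise; simp)+
  have "(\<Sum>l=k..<Suc m. c l * noise l \<omega>)\<^sup>2 = (S \<omega>)\<^sup>2 + 2 * c m * (S \<omega> * noise m \<omega>) + (c m)\<^sup>2 * (noise m \<omega>)\<^sup>2" for \<omega>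
    using step.hyps by (simp add: S_def[symmetric] power2_eq_square algebra_simps)
  then have "expectation (\<lambda>\<omega>. (\<Sum>l=k..<Suc m. c l * noise l \<omega>)\<^sup>2)
      = expectation (\<lambda>\<omega>. (S \<omega>)\<^sup>2) + 2 * c m * expectation (\<lambda>\<omega>. S \<omega> * noise m \<omega>)
        + (c m)\<^sup>2 * expectation (\<lambda>\<omega>. (noise m \<omega>)\<^sup>2)"
    using int by simp
  also have "\<dots> = expectation (\<lambda>\<omega>. (S \<omega>)\<^sup>2) + (c m)\<^sup>2 * (1 - expectation (\<lambda>\<omega>. (d m \<omega>)\<^sup>2))"
    by (simp only: noise_orthogonal[OF S] noise_second_moment mult_zero_right add_0_right)
  finally show ?case using step.IH step.hyps by (simp add: S_def)
qed simp

section \<open>The variance of scaled discrepancy increments\<close>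

text \<open>
  The conditional mean of the increment of \<open>l\<^sup>\<alpha> D\<^sub>l\<close> given the past, as \<open>d\<close> is that of the increment of \<open>D\<close>.
\<close>
definition compensator :: "real \<Rightarrow> nat \<Rightarrow> 'a \<Rightarrow> real" where
  "compensator \<alpha> l \<omega> = real (Suc l) powr \<alpha> * d l \<omega> + (real (Suc l) powr \<alpha> - real l powr \<alpha>) * D l \<omega>"

lemma determined_compensator: "l \<le> n \<Longrightarrow> determined n (compensator \<alpha> l)"
  unfolding compensator_def[abs_def] by (intro determined_intros) auto

lemma scaled_D_decomposition:
  assumes "k \<le> m"
  shows "real m powr \<alpha> * D m \<omega> - real k powr \<alpha> * D k \<omega>
    = (\<Sum>l=k..<m. real (Suc l) powr \<alpha> * noise l \<omega>) + (\<Sum>l=k..<m. compensator \<alpha> l \<omega>)"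
proof -
  have "real m powr \<alpha> * D m \<omega> - real k powr \<alpha> * D k \<omega>
      = (\<Sum>l=k..<m. real (Suc l) powr \<alpha> * D (Suc l) \<omega> - real l powr \<alpha> * D l \<omega>)"
    using sum_Suc_diff'[OF assms, of "\<lambda>l. real l powr \<alpha> * D l \<omega>"] by simp
  also have "\<dots> = (\<Sum>l=k..<m. real (Suc l) powr \<alpha> * noise l \<omega> + compensator \<alpha> l \<omega>)"
    by (intro sum.cong refl) (simp add: noise_def compensator_def algebra_simps del: of_nat_Suc)
  finally show ?thesis by (simp only: sum.distrib)
qed

text \<open>
  The estimates of the drift and of the compensator hold only in states with \<open>i + j = l\<close>. Such a state is
  occupied almost surely, which lets the pointwise bounds be integrated.
\<close>
lemma expectation_le_of_D_bound:
  assumes C: "C \<ge> 0" "\<And>i j. (real j - real i) * drift b r (i, j) \<le> C"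
    and Y: "determined l Y" and l: "l \<ge> 1"
    and bound: "\<And>\<omega>. fst (X l \<omega>) + snd (X l \<omega>) = l \<Longrightarrow> Y \<omega> \<le> p * (D l \<omega>)\<^sup>2 + q * D l \<omega> ^ 4 + s"
    and pq: "p \<ge> 0" "q \<ge> 0"
  shows "expectation Y \<le> p * ((2 * C + 1) * real l)
    + q * (((4 * C + 6) * (2 * C + 1) + 4 * C + 1) * (real l)\<^sup>2) + s"
proof -
  have int: "integrable M (\<lambda>\<omega>. (D l \<omega>)\<^sup>2)" "integrable M (\<lambda>\<omega>. D l \<omega> ^ 4)"
    by (intro determined_integrable[of l] determined_intros; simp)+
  have "expectation Y \<le> expectation (\<lambda>\<omega>. p * (D l \<omega>)\<^sup>2 + q * D l \<omega> ^ 4 + s)"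
  proof (rule integral_mono_AE)
    show "AE \<omega> in M. Y \<omega> \<le> p * (D l \<omega>)\<^sup>2 + q * D l \<omega> ^ 4 + s"
      using AE_total by eventually_elim (rule bound, blast)
  qed (use int determined_integrable[OF Y] in auto)
  also have "\<dots> = p * expectation (\<lambda>\<omega>. (D l \<omega>)\<^sup>2) + q * expectation (\<lambda>\<omega>. D l \<omega> ^ 4) + s"
    using int by (simp add: prob_space)
  also have "\<dots> \<le> p * ((2 * C + 1) * real l)
      + q * (((4 * C + 6) * (2 * C + 1) + 4 * C + 1) * (real l)\<^sup>2) + s"
    using pq by (intro add_mono mult_left_mono second_moment_bound[OF C] fourth_moment_bound[OF C]) auto
  finally show ?thesis .
qed

lemma drift_second_moment:
  assumes b: "power_weight \<alpha> b" and r: "power_weight \<alpha> r" and \<alpha>: "\<alpha> > 0"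
  obtains C where "C \<ge> 0" and "\<And>l. l \<ge> 1 \<Longrightarrow> expectation (\<lambda>\<omega>. (d l \<omega>)\<^sup>2) \<le> C / real l"
proof -
  obtain C where C: "C \<ge> 0" "\<And>i j. (real j - real i) * drift b r (i, j) \<le> C"
    by (rule drift_restoring[OF b r \<alpha>]) blast
  obtain A where A: "A \<ge> 0"
    "\<And>i j l x. l = i + j \<Longrightarrow> l \<ge> 1 \<Longrightarrow> x = (real j - real i) / real l \<Longrightarrow>
       \<bar>drift b r (i, j) + \<alpha> * x\<bar> \<le> A * (x\<^sup>2 + 1 / real l)"
    by (rule drift_linearization[OF b r]) blast
  define Q where "Q = 2 * (\<alpha> + A)\<^sup>2"
  have Q: "Q \<ge> 0" by (simp add: Q_def)
  have "expectation (\<lambda>\<omega>. (d l \<omega>)\<^sup>2) \<le> Q * (2 * C + 2) / real l" if l: "l \<ge> 1" for l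
  proof -
    have "expectation (\<lambda>\<omega>. (d l \<omega>)\<^sup>2) \<le> (Q / (real l)\<^sup>2) * ((2 * C + 1) * real l)
      + 0 * (((4 * C + 6) * (2 * C + 1) + 4 * C + 1) * (real l)\<^sup>2) + Q / (real l)\<^sup>2"
    proof (rule expectation_le_of_D_bound[OF C _ l])
      show "determined l (\<lambda>\<omega>. (d l \<omega>)\<^sup>2)" by (intro determined_intros) simp
      fix \<omega> assume tot: "fst (X l \<omega>) + snd (X l \<omega>) = l"
      define x where "x = D l \<omega> / real l"
      have "real (fst (X l \<omega>)) + real (snd (X l \<omega>)) = real l"
        unfolding of_nat_add[symmetric] tot ..
      then have "\<bar>D l \<omega>\<bar> \<le> real l" unfolding D_eq by linarith
      then have x1: "\<bar>x\<bar> \<le> 1" using l by (simp add: x_def)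
      have dx: "\<bar>d l \<omega> + \<alpha> * x\<bar> \<le> A * (x\<^sup>2 + 1 / real l)"
        using A(2)[of l "fst (X l \<omega>)" "snd (X l \<omega>)" x] tot l by (simp add: x_def D_eq)
      have "x\<^sup>2 \<le> \<bar>x\<bar>" using x1 mult_right_mono[of "\<bar>x\<bar>" 1 "\<bar>x\<bar>"] by (simp add: power2_eq_square)
      then have "A * (x\<^sup>2 + 1 / real l) \<le> A * (\<bar>x\<bar> + 1 / real l)" using A(1) by (intro mult_left_mono) auto
      moreover have "\<bar>\<alpha> * x\<bar> = \<alpha> * \<bar>x\<bar>" using \<alpha> by (simp add: abs_mult)
      moreover have "\<alpha> * (1 / real l) \<ge> 0" using \<alpha> by simp
      ultimately have "\<bar>d l \<omega>\<bar> \<le> (\<alpha> + A) * (\<bar>x\<bar> + 1 / real l)"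
        using dx unfolding distrib_left distrib_right by linarith
      then have "\<bar>d l \<omega>\<bar>\<^sup>2 \<le> ((\<alpha> + A) * (\<bar>x\<bar> + 1 / real l))\<^sup>2" by (intro power_mono) auto
      also have "\<dots> = (\<alpha> + A)\<^sup>2 * (\<bar>x\<bar> + 1 / real l)\<^sup>2" by (rule power_mult_distrib)
      also have "\<dots> \<le> (\<alpha> + A)\<^sup>2 * (2 * (x\<^sup>2 + 1 / (real l)\<^sup>2))"
      proof (intro mult_left_mono)
        have "0 \<le> (\<bar>x\<bar> - 1 / real l)\<^sup>2" by simp
        then show "(\<bar>x\<bar> + 1 / real l)\<^sup>2 \<le> 2 * (x\<^sup>2 + 1 / (real l)\<^sup>2)"
          unfolding power2_sum power2_diff by (simp add: power_divide)
      qed simp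
      also have "\<dots> = Q * x\<^sup>2 + Q / (real l)\<^sup>2" by (simp add: Q_def algebra_simps)
      finally show "(d l \<omega>)\<^sup>2 \<le> Q / (real l)\<^sup>2 * (D l \<omega>)\<^sup>2 + 0 * D l \<omega> ^ 4 + Q / (real l)\<^sup>2"
        by (simp add: x_def power_divide)
    qed (use Q in auto)
    also have "\<dots> \<le> Q * (2 * C + 1) / real l + Q / real l"
    proof -
      have "real l \<le> (real l)\<^sup>2" using l by (simp add: power2_eq_square)
      then have "Q / (real l)\<^sup>2 \<le> Q / real l" using Q l by (intro divide_left_mono) auto
      then show ?thesis using l by (simp add: power2_eq_square)
    qed
    also have "\<dots> = Q * (2 * C + 2) / real l" by (simp add: add_divide_distrib[symmetric] algebra_simps)
    finally show ?thesis .
  qed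
  then show thesis using that[of "Q * (2 * C + 2)"] Q C(1) by simp
qed

lemma compensator_second_moment:
  assumes b: "power_weight \<alpha> b" and r: "power_weight \<alpha> r" and \<alpha>: "\<alpha> > 0"
  obtains C where "C \<ge> 0"
    and "\<And>l. l \<ge> 1 \<Longrightarrow> expectation (\<lambda>\<omega>. (compensator \<alpha> l \<omega>)\<^sup>2) \<le> C * real l powr (2 * \<alpha>) / (real l)\<^sup>2"
proof -
  obtain C where C: "C \<ge> 0" "\<And>i j. (real j - real i) * drift b r (i, j) \<le> C"
    by (rule drift_restoring[OF b r \<alpha>]) blast
  obtain A where A: "A \<ge> 0"
    "\<And>i j l x. l = i + j \<Longrightarrow> l \<ge> 1 \<Longrightarrow> x = (real j - real i) / real l \<Longrightarrow>
       \<bar>real (Suc l) powr \<alpha> * drift b r (i, j) + (real (Suc l) powr \<alpha> - real l powr \<alpha>) * (real j - real i)\<bar>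
       \<le> A * real l powr \<alpha> * (x\<^sup>2 + 1 / real l)"
    by (rule compensator_bound[OF b r]) blast
  define F where "F = (4 * C + 6) * (2 * C + 1) + 4 * C + 1"
  have F: "F \<ge> 0" using C(1) by (simp add: F_def)
  have "expectation (\<lambda>\<omega>. (compensator \<alpha> l \<omega>)\<^sup>2) \<le> 2 * A\<^sup>2 * (F + 1) * real l powr (2 * \<alpha>) / (real l)\<^sup>2"
    if l: "l \<ge> 1" for l
  proof -
    define P where "P = 2 * A\<^sup>2 * real l powr (2 * \<alpha>)"
    have P: "P \<ge> 0" by (simp add: P_def)
    have "expectation (\<lambda>\<omega>. (compensator \<alpha> l \<omega>)\<^sup>2) \<le> 0 * ((2 * C + 1) * real l)
      + (P / real l ^ 4) * (((4 * C + 6) * (2 * C + 1) + 4 * C + 1) * (real l)\<^sup>2) + P / (real l)\<^sup>2"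
    proof (rule expectation_le_of_D_bound[OF C _ l])
      show "determined l (\<lambda>\<omega>. (compensator \<alpha> l \<omega>)\<^sup>2)" by (intro determined_intros determined_compensator) simp
      fix \<omega> assume tot: "fst (X l \<omega>) + snd (X l \<omega>) = l"
      define x where "x = D l \<omega> / real l"
      have "\<bar>compensator \<alpha> l \<omega>\<bar> \<le> A * real l powr \<alpha> * (x\<^sup>2 + 1 / real l)"
        using A(2)[of l "fst (X l \<omega>)" "snd (X l \<omega>)" x] tot l
        by (simp add: x_def D_eq compensator_def)
      then have "\<bar>compensator \<alpha> l \<omega>\<bar>\<^sup>2 \<le> (A * real l powr \<alpha> * (x\<^sup>2 + 1 / real l))\<^sup>2" by (intro power_mono) auto
      also have "\<dots> = A\<^sup>2 * real l powr (2 * \<alpha>) * (x\<^sup>2 + 1 / real l)\<^sup>2"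
        by (simp add: power_mult_distrib powr_add[symmetric] power2_eq_square)
      also have "\<dots> \<le> A\<^sup>2 * real l powr (2 * \<alpha>) * (2 * (x ^ 4 + 1 / (real l)\<^sup>2))"
      proof (intro mult_left_mono)
        have "0 \<le> (x\<^sup>2 - 1 / real l)\<^sup>2" by simp
        then show "(x\<^sup>2 + 1 / real l)\<^sup>2 \<le> 2 * (x ^ 4 + 1 / (real l)\<^sup>2)"
          unfolding power2_sum power2_diff by (simp add: power_divide)
      qed simp
      also have "\<dots> = P * x ^ 4 + P / (real l)\<^sup>2" by (simp add: P_def algebra_simps)
      finally show "(compensator \<alpha> l \<omega>)\<^sup>2 \<le> 0 * (D l \<omega>)\<^sup>2 + P / real l ^ 4 * D l \<omega> ^ 4 + P / (real l)\<^sup>2"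
        by (simp add: x_def power_divide)
    qed (use P in auto)
    also have "\<dots> = P * (F + 1) / (real l)\<^sup>2"
    proof -
      have "P / real l ^ 4 * (F * (real l)\<^sup>2) = P * F / (real l)\<^sup>2"
        using l by (simp add: power4_eq_xxxx power2_eq_square)
      then show ?thesis unfolding F_def[symmetric] by (simp add: add_divide_distrib distrib_left)
    qed
    finally show ?thesis by (simp add: P_def ac_simps)
  qed
  then show thesis using that[of "2 * A\<^sup>2 * (F + 1)"] F by simp
qed

text \<open>
  The martingale part carries the main term, and Cauchy-Schwarz over the at most \<open>2 n\<close> summands
  suffices for the compensators, since each has mean square \<open>O(n\<^bsup>2\<alpha>-2\<^esup>)\<close>. The perturbation lemma is
  used with \<open>t = \<surd>n\<close>, the ratio of the orders of the two root mean squares.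
\<close>
lemma scaled_increment_variance:
  assumes b: "power_weight \<alpha> b" and r: "power_weight \<alpha> r" and \<alpha>: "\<alpha> > 0" and \<delta>: "\<delta> > 0"
  obtains C where "C \<ge> 0"
    and "\<And>n k m. n \<ge> 1 \<Longrightarrow> \<delta> * real n \<le> real k \<Longrightarrow> k \<le> m \<Longrightarrow> m \<le> 2 * n \<Longrightarrow>
      \<bar>variance (\<lambda>\<omega>. real m powr \<alpha> * D m \<omega> - real k powr \<alpha> * D k \<omega>)
        - (real m powr (2 * \<alpha> + 1) - real k powr (2 * \<alpha> + 1)) / (2 * \<alpha> + 1)\<bar>
      \<le> C * real n powr (2 * \<alpha>) * sqrt (real n)"
proof -
  obtain C\<^sub>d where Cd: "C\<^sub>d \<ge> 0" "\<And>l. l \<ge> 1 \<Longrightarrow> expectation (\<lambda>\<omega>. (d l \<omega>)\<^sup>2) \<le> C\<^sub>d / real l"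
    by (rule drift_second_moment[OF b r \<alpha>]) blast
  obtain C\<^sub>c where Cc: "C\<^sub>c \<ge> 0" "\<And>l. l \<ge> 1 \<Longrightarrow>
      expectation (\<lambda>\<omega>. (compensator \<alpha> l \<omega>)\<^sup>2) \<le> C\<^sub>c * real l powr (2 * \<alpha>) / (real l)\<^sup>2"
    by (rule compensator_second_moment[OF b r \<alpha>]) blast
  define C where "C = (3 + 2 * C\<^sub>d / \<delta> + 8 * C\<^sub>c / \<delta>\<^sup>2) * 2 powr (2 * \<alpha>)"
  have C: "C \<ge> 0" using Cd Cc \<delta> by (simp add: C_def)
  have "\<bar>variance (\<lambda>\<omega>. real m powr \<alpha> * D m \<omega> - real k powr \<alpha> * D k \<omega>)
        - (real m powr (2 * \<alpha> + 1) - real k powr (2 * \<alpha> + 1)) / (2 * \<alpha> + 1)\<bar>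
      \<le> C * real n powr (2 * \<alpha>) * sqrt (real n)"
    if n: "n \<ge> 1" and k: "\<delta> * real n \<le> real k" and km: "k \<le> m" and m: "m \<le> 2 * n" for n k m
  proof -
    define P where "P = real (2 * n) powr (2 * \<alpha>)"
    define t where "t = sqrt (real n)"
    have t: "t \<ge> 1" "t * t = real n" using n by (auto simp: t_def)
    have P: "P \<ge> 0" by (simp add: P_def)
    have \<delta>n: "\<delta> * real n > 0" using \<delta> n by simp
    then have "real k > 0" using k by linarith
    then have k1: "k \<ge> 1" by simp
    have lk: "l \<ge> 1" "\<delta> * real n \<le> real l" "real (Suc l) powr (2 * \<alpha>) \<le> P" "real l powr (2 * \<alpha>) \<le> P"
      if "l \<in> {k..<m}" for l
      using that k k1 m \<alpha> by (auto simp: P_def intro!: powr_mono2)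
    have card: "real (m - k) \<le> 2 * real n" using m by simp
    define S where "S \<omega> = (\<Sum>l=k..<m. real (Suc l) powr \<alpha> * noise l \<omega>)" for \<omega>
    define R where "R \<omega> = (\<Sum>l=k..<m. compensator \<alpha> l \<omega>)" for \<omega>
    have S: "determined m S" unfolding S_def[abs_def]
      by (intro determined_intros determined_noise) auto
    have R: "determined m R" unfolding R_def[abs_def]
      by (intro determined_sum determined_compensator) auto
    have intS: "integrable M S" "integrable M R" "integrable M (\<lambda>\<omega>. (S \<omega>)\<^sup>2)"
      "integrable M (\<lambda>\<omega>. S \<omega> * R \<omega>)" "integrable M (\<lambda>\<omega>. (R \<omega>)\<^sup>2)"
      by (intro determined_integrable[of m] determined_intros S R; simp)+
    have meanS: "expectation S = 0"
    proof -
      have "integrable M (\<lambda>\<omega>. real (Suc l) powr \<alpha> * noise l \<omega>)" for l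
        by (intro determined_integrable[of "Suc l"] determined_intros determined_noise) simp
      moreover have "expectation (noise l) = 0" for l
        using noise_orthogonal[OF determined_const[of l 1]] by simp
      ultimately show ?thesis unfolding S_def[abs_def] by (simp add: Bochner_Integration.integral_sum)
    qed

    have d2: "0 \<le> expectation (\<lambda>\<omega>. (d l \<omega>)\<^sup>2)" for l by simp
    have ES: "expectation (\<lambda>\<omega>. (S \<omega>)\<^sup>2) = (\<Sum>l=k..<m. real (Suc l) powr (2 * \<alpha>) * (1 - expectation (\<lambda>\<omega>. (d l \<omega>)\<^sup>2)))"
      unfolding S_def martingale_second_moment[OF km]
      by (simp add: power2_eq_square powr_add[symmetric])
    define T where "T = (\<Sum>l=k..<m. real (Suc l) powr (2 * \<alpha>))"
    define U where "U = (\<Sum>l=k..<m. real (Suc l) powr (2 * \<alpha>) * expectation (\<lambda>\<omega>. (d l \<omega>)\<^sup>2))"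
    have EST: "expectation (\<lambda>\<omega>. (S \<omega>)\<^sup>2) = T - U"
      unfolding ES T_def U_def by (simp only: right_diff_distrib mult_1_right sum_subtractf)
    have U0: "U \<ge> 0" unfolding U_def using d2 by (intro sum_nonneg mult_nonneg_nonneg) auto
    have "U \<le> (\<Sum>l=k..<m. P * (C\<^sub>d / (\<delta> * real n)))"
      unfolding U_def
    proof (rule sum_mono)
      fix l assume l: "l \<in> {k..<m}"
      have "expectation (\<lambda>\<omega>. (d l \<omega>)\<^sup>2) \<le> C\<^sub>d / real l" by (rule Cd(2)[OF lk(1)[OF l]])
      also have "\<dots> \<le> C\<^sub>d / (\<delta> * real n)"
        using lk(2)[OF l] \<delta>n Cd(1) by (intro divide_left_mono) auto
      finally show "real (Suc l) powr (2 * \<alpha>) * expectation (\<lambda>\<omega>. (d l \<omega>)\<^sup>2) \<le> P * (C\<^sub>d / (\<delta> * real n))"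
        using lk(3)[OF l] d2 P by (intro mult_mono) auto
    qed
    also have "\<dots> = real (m - k) * (P * (C\<^sub>d / (\<delta> * real n)))" by simp
    also have "\<dots> \<le> (2 * real n) * (P * (C\<^sub>d / (\<delta> * real n)))"
      using card P Cd(1) \<delta>n by (intro mult_right_mono mult_nonneg_nonneg divide_nonneg_pos) auto
    also have "\<dots> = 2 * C\<^sub>d / \<delta> * P" using n by simp
    finally have U: "U \<le> 2 * C\<^sub>d / \<delta> * P" .
    have "T \<le> (\<Sum>l=k..<m. P)" unfolding T_def using lk(3) by (rule sum_mono)
    also have "\<dots> = real (m - k) * P" by simp
    also have "\<dots> \<le> 2 * real n * P" using card P by (intro mult_right_mono) auto
    finally have T: "T \<le> 2 * real n * P" .
    have "real m powr (2 * \<alpha>) \<le> P" unfolding P_def using m \<alpha> by (intro powr_mono2) auto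
    then have TI: "\<bar>T - (real m powr (2 * \<alpha> + 1) - real k powr (2 * \<alpha> + 1)) / (2 * \<alpha> + 1)\<bar> \<le> P"
      unfolding T_def using power_sum_integral_comparison[of "2 * \<alpha>" k m] \<alpha> k1 km by linarith

    have ER: "expectation (\<lambda>\<omega>. (R \<omega>)\<^sup>2) \<le> 4 * C\<^sub>c / \<delta>\<^sup>2 * P"
    proof -
      have intc: "integrable M (\<lambda>\<omega>. (compensator \<alpha> l \<omega>)\<^sup>2)" for l
        by (intro determined_integrable[of l] determined_intros determined_compensator) simp
      have "expectation (\<lambda>\<omega>. (R \<omega>)\<^sup>2) \<le> expectation (\<lambda>\<omega>. real (m - k) * (\<Sum>l=k..<m. (compensator \<alpha> l \<omega>)\<^sup>2))"
      proof (rule integral_mono)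
        show "(R \<omega>)\<^sup>2 \<le> real (m - k) * (\<Sum>l=k..<m. (compensator \<alpha> l \<omega>)\<^sup>2)" for \<omega>
          unfolding R_def using sum_squared_le_sum_of_squares[of "\<lambda>l. compensator \<alpha> l \<omega>" "{k..<m}"]
          by (simp add: mult.commute)
      qed (use intS intc in auto)
      also have "\<dots> = real (m - k) * (\<Sum>l=k..<m. expectation (\<lambda>\<omega>. (compensator \<alpha> l \<omega>)\<^sup>2))"
        using intc by (simp add: Bochner_Integration.integral_sum)
      also have "\<dots> \<le> real (m - k) * (\<Sum>l=k..<m. C\<^sub>c * P / (\<delta> * real n)\<^sup>2)"
      proof (intro mult_left_mono sum_mono)
        fix l assume l: "l \<in> {k..<m}"
        have "expectation (\<lambda>\<omega>. (compensator \<alpha> l \<omega>)\<^sup>2) \<le> C\<^sub>c * real l powr (2 * \<alpha>) / (real l)\<^sup>2"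
          by (rule Cc(2)[OF lk(1)[OF l]])
        also have "\<dots> \<le> C\<^sub>c * P / (\<delta> * real n)\<^sup>2"
          using lk(2,4)[OF l] \<delta>n Cc(1) P \<delta>
          by (intro frac_le mult_left_mono power_mono zero_less_power mult_nonneg_nonneg) auto
        finally show "expectation (\<lambda>\<omega>. (compensator \<alpha> l \<omega>)\<^sup>2) \<le> C\<^sub>c * P / (\<delta> * real n)\<^sup>2" .
      qed simp
      also have "\<dots> = (real (m - k) * real (m - k)) * (C\<^sub>c * P / (\<delta> * real n)\<^sup>2)" by simp
      also have "\<dots> \<le> ((2 * real n) * (2 * real n)) * (C\<^sub>c * P / (\<delta> * real n)\<^sup>2)"
        using card Cc(1) P by (intro mult_right_mono mult_mono) auto
      also have "\<dots> = 4 * C\<^sub>c / \<delta>\<^sup>2 * P" using n \<delta> by (simp add: power2_eq_square)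
      finally show ?thesis .
    qed
    have "\<bar>variance (\<lambda>\<omega>. S \<omega> + R \<omega>) - expectation (\<lambda>\<omega>. (S \<omega>)\<^sup>2)\<bar>
      \<le> expectation (\<lambda>\<omega>. (S \<omega>)\<^sup>2) / t + (t + 1) * expectation (\<lambda>\<omega>. (R \<omega>)\<^sup>2)"
      using t by (intro variance_perturbation intS meanS) auto
    also have "\<dots> \<le> 2 * real n * P / t + (2 * t) * (4 * C\<^sub>c / \<delta>\<^sup>2 * P)"
    proof (intro add_mono)
      have "expectation (\<lambda>\<omega>. (S \<omega>)\<^sup>2) \<le> 2 * real n * P" using EST T U0 by linarith
      then show "expectation (\<lambda>\<omega>. (S \<omega>)\<^sup>2) / t \<le> 2 * real n * P / t" using t by (intro divide_right_mono) auto
      show "(t + 1) * expectation (\<lambda>\<omega>. (R \<omega>)\<^sup>2) \<le> (2 * t) * (4 * C\<^sub>c / \<delta>\<^sup>2 * P)"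
        using t ER by (intro mult_mono) auto
    qed
    also have "2 * real n * P / t = 2 * t * P" unfolding t(2)[symmetric] using t(1) by simp
    finally have V: "\<bar>variance (\<lambda>\<omega>. S \<omega> + R \<omega>) - expectation (\<lambda>\<omega>. (S \<omega>)\<^sup>2)\<bar>
      \<le> 2 * t * P + (2 * t) * (4 * C\<^sub>c / \<delta>\<^sup>2 * P)" .
    have eq: "real m powr \<alpha> * D m \<omega> - real k powr \<alpha> * D k \<omega> = S \<omega> + R \<omega>" for \<omega>
      unfolding S_def R_def by (rule scaled_D_decomposition[OF km])
    have "\<bar>variance (\<lambda>\<omega>. real m powr \<alpha> * D m \<omega> - real k powr \<alpha> * D k \<omega>)
        - (real m powr (2 * \<alpha> + 1) - real k powr (2 * \<alpha> + 1)) / (2 * \<alpha> + 1)\<bar>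
      \<le> (P + 2 * C\<^sub>d / \<delta> * P) + (2 * t * P + (2 * t) * (4 * C\<^sub>c / \<delta>\<^sup>2 * P))"
      unfolding eq using V[unfolded EST] TI U U0 by linarith
    also have "\<dots> \<le> t * (P + 2 * C\<^sub>d / \<delta> * P) + (2 * t * P + (2 * t) * (4 * C\<^sub>c / \<delta>\<^sup>2 * P))"
      using mult_right_mono[OF t(1), of "P + 2 * C\<^sub>d / \<delta> * P"] P Cd(1) \<delta> by simp
    also have "\<dots> = (3 + 2 * C\<^sub>d / \<delta> + 8 * C\<^sub>c / \<delta>\<^sup>2) * P * t" by (simp add: algebra_simps)
    also have "\<dots> = C * real n powr (2 * \<alpha>) * sqrt (real n)"
      by (simp add: C_def P_def t_def powr_mult)
    finally show ?thesis .
  qed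
  then show thesis using that[OF C] by blast
qed

end

theorem lemma3p2:
  fixes \<alpha> B :: real and w :: "nat \<Rightarrow> real" and t :: urn_type
    and M :: "'a measure" and X :: "nat \<Rightarrow> 'a \<Rightarrow> nat \<times> nat"
  assumes "\<alpha> > 0"
    and "\<And>n. w n > 0"
    and "\<exists>E. E \<in> O(\<lambda>n. 1 / (real n)\<^sup>2) \<and>
           (\<forall>\<^sub>F n in sequentially. 1 / w n = real n powr \<alpha> * (1 + 2 * B / real n + E n))"
    and "urn_of_type t w M X"
  shows "\<forall>\<delta>\<in>{0<..<2}. \<exists>C\<^sub>2::real. \<forall>\<^sub>F n::nat in sequentially. \<forall>k m::nat.
           \<delta> * real n \<le> real k \<and> k \<le> m \<and> m \<le> 2 * n \<longrightarrow>
           \<bar>prob_space.variance M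
               (\<lambda>\<omega>. discrepancy X m \<omega> * (real m / real n) powr \<alpha>
                     - discrepancy X k \<omega> * (real k / real n) powr \<alpha>)
             - real n * integral {real k / real n..real m / real n} (\<lambda>u. u powr (2 * \<alpha>))\<bar>
           \<le> C\<^sub>2 * sqrt (real n) * (ln (real n))\<^sup>2"
proof
  fix \<delta> :: real assume "\<delta> \<in> {0<..<2}"
  then have \<delta>: "\<delta> > 0" by simp
  obtain E where E: "E \<in> O(\<lambda>n. 1 / (real n)\<^sup>2)"
      "\<forall>\<^sub>F n in sequentially. 1 / w n = real n powr \<alpha> * (1 + 2 * B / real n + E n)"
    using assms(3) by blast
  have even: "power_weight \<alpha> (\<lambda>i. w (2 * i))" and odd: "power_weight \<alpha> (\<lambda>i. w (2 * i + 1))"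
    using power_weight_subsequence[OF assms(2) _ E, of 0] power_weight_subsequence[OF assms(2) _ E, of 1]
    by simp_all
  have "blue_weight t w = (\<lambda>i. w (2 * i)) \<or> blue_weight t w = (\<lambda>i. w (2 * i + 1))"
    "red_weight t w = (\<lambda>i. w (2 * i)) \<or> red_weight t w = (\<lambda>i. w (2 * i + 1))"
    by (cases t; simp add: fun_eq_iff)+
  then have b: "power_weight \<alpha> (blue_weight t w)" and r: "power_weight \<alpha> (red_weight t w)"
    using even odd by metis+
  have urn: "polya_urn M (blue_weight t w) (red_weight t w) X"
    using assms(4) by (simp add: urn_of_type_def)
  interpret prob_space M using urn by (simp add: polya_urn_def)
  interpret positive_urn M "blue_weight t w" "red_weight t w" X
    using urn b r by unfold_locales (auto simp: power_weight_def)
  obtain C where C: "C \<ge> 0" "\<And>n k m. n \<ge> 1 \<Longrightarrow> \<delta> * real n \<le> real k \<Longrightarrow> k \<le> m \<Longrightarrow> m \<le> 2 * n \<Longrightarrow>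
      \<bar>variance (\<lambda>\<omega>. real m powr \<alpha> * D m \<omega> - real k powr \<alpha> * D k \<omega>)
        - (real m powr (2 * \<alpha> + 1) - real k powr (2 * \<alpha> + 1)) / (2 * \<alpha> + 1)\<bar>
      \<le> C * real n powr (2 * \<alpha>) * sqrt (real n)"
    by (rule scaled_increment_variance[OF b r assms(1) \<delta>]) blast
  have "\<bar>variance (\<lambda>\<omega>. D m \<omega> * (real m / real n) powr \<alpha> - D k \<omega> * (real k / real n) powr \<alpha>)
         - real n * integral {real k / real n..real m / real n} (\<lambda>u. u powr (2 * \<alpha>))\<bar>
       \<le> C * sqrt (real n) * (ln (real n))\<^sup>2"
    if n: "n \<ge> 3" and k: "\<delta> * real n \<le> real k" "k \<le> m" "m \<le> 2 * n" for n k m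
  proof -
    define N where "N = real n powr (2 * \<alpha>)"
    define Z where "Z \<omega> = real m powr \<alpha> * D m \<omega> - real k powr \<alpha> * D k \<omega>" for \<omega>
    define I where "I = (real m powr (2 * \<alpha> + 1) - real k powr (2 * \<alpha> + 1)) / (2 * \<alpha> + 1)"
    have n0: "real n > 0" using n by simp
    have N: "N > 0" using n by (simp add: N_def)
    have "0 < \<delta> * real n" using \<delta> n0 by simp
    then have k0: "real k > 0" using k(1) by linarith
    have scale: "D m \<omega> * (real m / real n) powr \<alpha> - D k \<omega> * (real k / real n) powr \<alpha>
        = inverse (real n powr \<alpha>) * Z \<omega>" for \<omega>
      using n0 by (simp add: Z_def powr_divide field_simps)
    have "variance (\<lambda>\<omega>. inverse (real n powr \<alpha>) * Z \<omega>) = (inverse (real n powr \<alpha>))\<^sup>2 * variance Z"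
      by (simp add: right_diff_distrib[symmetric] power_mult_distrib)
    moreover have "(inverse (real n powr \<alpha>))\<^sup>2 = 1 / N"
      by (simp add: N_def power2_eq_square powr_add[symmetric] field_simps)
    ultimately have var: "variance (\<lambda>\<omega>. D m \<omega> * (real m / real n) powr \<alpha> - D k \<omega> * (real k / real n) powr \<alpha>)
        = variance Z / N" unfolding scale by simp
    have "integral {real k / real n..real m / real n} (\<lambda>u. u powr (2 * \<alpha>))
        = ((real m / real n) powr (2 * \<alpha> + 1) - (real k / real n) powr (2 * \<alpha> + 1)) / (2 * \<alpha> + 1)"
      using n0 k0 k assms(1) by (intro integral_powr_interval divide_right_mono) auto
    also have "\<dots> = I / (real n powr (2 * \<alpha> + 1))"
      by (simp add: I_def powr_divide diff_divide_distrib mult.commute)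
    also have "real n powr (2 * \<alpha> + 1) = N * real n" using n0 by (simp add: N_def powr_add)
    finally have int: "real n * integral {real k / real n..real m / real n} (\<lambda>u. u powr (2 * \<alpha>)) = I / N"
      using n0 by simp
    have ln1: "1 \<le> (ln (real n))\<^sup>2"
    proof -
      have "exp 1 \<le> real n" using n exp_le by linarith
      then have "1 \<le> ln (real n)" using n0 by (simp add: ln_ge_iff)
      then show ?thesis by (rule one_le_power)
    qed
    have "\<bar>variance Z - I\<bar> \<le> C * N * sqrt (real n)"
      unfolding Z_def[abs_def] I_def N_def using C(2)[of n k m] n k by simp
    then have "\<bar>variance Z - I\<bar> / N \<le> C * N * sqrt (real n) / N"
      using N by (intro divide_right_mono) auto
    moreover have "\<bar>variance Z / N - I / N\<bar> = \<bar>variance Z - I\<bar> / N"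
      using N by (simp only: diff_divide_distrib[symmetric] abs_divide abs_of_pos)
    ultimately have "\<bar>variance Z / N - I / N\<bar> \<le> C * sqrt (real n)" using N by simp
    also have "\<dots> \<le> C * sqrt (real n) * (ln (real n))\<^sup>2"
      using mult_left_mono[OF ln1, of "C * sqrt (real n)"] C(1) by simp
    finally show ?thesis unfolding var int .
  qed
  then show "\<exists>C\<^sub>2::real. \<forall>\<^sub>F n::nat in sequentially. \<forall>k m::nat.
           \<delta> * real n \<le> real k \<and> k \<le> m \<and> m \<le> 2 * n \<longrightarrow>
           \<bar>prob_space.variance M
               (\<lambda>\<omega>. discrepancy X m \<omega> * (real m / real n) powr \<alpha>
                     - discrepancy X k \<omega> * (real k / real n) powr \<alpha>)
             - real n * integral {real k / real n..real m / real n} (\<lambda>u. u powr (2 * \<alpha>))\<bar>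
           \<le> C\<^sub>2 * sqrt (real n) * (ln (real n))\<^sup>2"
    by (intro exI[of _ C] eventually_sequentiallyI[of 3]) blast
qed

end
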